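(* Let $k,\ell,c,n\in\mathbb N$ be such that $\ell\geq c$. Let $T\in\mathcal T(k,\ell,c)$, and let $G$ be a graph of order $n$ such that at least $n/2$ vertices of $G$ have degree at least $k$. If $c$ is even, or $\ell+c\geq\lfloor n/2\rfloor$ (or both), then $T$ is a subgraph of $G$.
   Context: Here $\mathbb N=\{1,2,3,\dots\}$. Graphs are finite, simple and undirected; the order of a graph is its number of vertices. A graph $H$ is called a subgraph of $G$ if there is an injective map $V(H)\to V(G)$ that preserves adjacencies (so containment is up to isomorphism and need not be induced). The length of a path is its number of edges. $\mathcal T(k,\ell,c)$ denotes the class of all trees with $k$ edges which can be obtained from a path $P$ of length $k-\ell$ and two stars $S_1$ and $S_2$ by identifying the centres of the $S_i$ with two vertices that lie at distance $c$ from each other on $P$. Equivalently: for integers $a,b,c,d,e\ge 0$ let $C(a,b,c,d,e)$ be the tree obtained from a path $P$ of length $a+c+e$ by attaching $b$ new leaves to the $(a+1)$th vertex of $P$ and $d$ new leaves to the $(a+c+1)$th vertex of $P$; then $\mathcal T(k,\ell,c)$ is the class of all trees $C(a,b,c,d,e)$ with $b+d=\ell$ and $a+b+c+d+e=k$ (a star may be trivial, i.e. $b=0$ or $d=0$ is allowed). *)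

theory Defs
  imports Complex_Main "Graph_Theory.Graph_Theory"
begin

text \<open>
  A finite simple undirected graph is a \<^locale>\<open>pair_graph\<close>: a finite vertex set with an irreflexive
  symmetric set of arcs, each undirected edge being represented by its two orientations. Hence the
  degree of a vertex is its \<^const>\<open>out_degree\<close>.
\<close>

text \<open>
  Containment up to isomorphism, not necessarily induced.
\<close>
definition contains_subgraph :: "'a pair_pre_digraph \<Rightarrow> 'b pair_pre_digraph \<Rightarrow> bool" where
  "contains_subgraph G H \<longleftrightarrow>
     (\<exists>f. inj_on f (pverts H) \<and> f ` pverts H \<subseteq> pverts G \<and>
          (\<forall>u v. (u, v) \<in> parcs H \<longrightarrow> (f u, f v) \<in> parcs G))"

datatype double_broom_vertex = Path nat | Leaf1 nat | Leaf2 nat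

text \<open>
  The tree \<open>C(a,b,c,d,e)\<close>. The path has the vertices \<open>Path 0, \<dots>, Path (a + c + e)\<close>, so that its
  \<open>(a+1)\<close>th vertex is \<open>Path a\<close> and its \<open>(a+c+1)\<close>th vertex is \<open>Path (a + c)\<close>.
\<close>
definition double_broom_edges :: "nat \<Rightarrow> nat \<Rightarrow> nat \<Rightarrow> nat \<Rightarrow> nat \<Rightarrow> double_broom_vertex rel" where
  "double_broom_edges a b c d e =
     {(Path i, Path (Suc i)) | i. i < a + c + e} \<union>
     {(Path a, Leaf1 j) | j. j < b} \<union>
     {(Path (a + c), Leaf2 j) | j. j < d}"

definition double_broom ::
  "nat \<Rightarrow> nat \<Rightarrow> nat \<Rightarrow> nat \<Rightarrow> nat \<Rightarrow> double_broom_vertex pair_pre_digraph" where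
  "double_broom a b c d e =
     \<lparr> pverts = Path ` {..a + c + e} \<union> Leaf1 ` {..<b} \<union> Leaf2 ` {..<d},
       parcs = double_broom_edges a b c d e \<union> (double_broom_edges a b c d e)\<inverse> \<rparr>"

text \<open>
  The class \<open>\<T>(k,\<ell>,c)\<close>, closed under isomorphism.
\<close>
definition tree_class :: "nat \<Rightarrow> nat \<Rightarrow> nat \<Rightarrow> 'b pair_pre_digraph set" where
  "tree_class k l c =
     {T. \<exists>a b d e. b + d = l \<and> a + b + c + d + e = k \<and>
           digraph_iso (with_proj (double_broom a b c d e)) (with_proj T)}"

lemma finite_double_broom_edges: "finite (double_broom_edges a b c d e)"
  unfolding double_broom_edges_def by auto

lemma pair_graph_double_broom: "pair_graph (double_broom a b c d e)"
proof
  show "finite (pverts (double_broom a b c d e))" "finite (parcs (double_broom a b c d e))"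
    by (auto simp: double_broom_def finite_double_broom_edges)
  show "symmetric (with_proj (double_broom a b c d e))"
    by (auto simp: symmetric_def double_broom_def sym_Un_converse)
qed (auto simp: double_broom_def double_broom_edges_def)

lemma card_double_broom_edges: "card (double_broom_edges a b c d e) = a + b + c + d + e"
proof -
  let ?P = "(\<lambda>i. (Path i, Path (Suc i))) ` {..<a + c + e}"
  let ?A = "(\<lambda>j. (Path a, Leaf1 j)) ` {..<b}"
  let ?B = "(\<lambda>j. (Path (a + c), Leaf2 j)) ` {..<d}"
  have "double_broom_edges a b c d e = ?P \<union> (?A \<union> ?B)"
    by (auto simp: double_broom_edges_def)
  moreover have "card (?P \<union> (?A \<union> ?B)) = card ?P + card (?A \<union> ?B)"
    by (rule card_Un_disjoint) auto
  moreover have "card (?A \<union> ?B) = card ?A + card ?B"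
    by (rule card_Un_disjoint) auto
  ultimately show ?thesis
    by (simp add: card_image inj_on_def)
qed

lemma card_pverts_double_broom: "card (pverts (double_broom a b c d e)) = a + b + c + d + e + 1"
proof -
  let ?P = "Path ` {..a + c + e}"
  let ?A = "Leaf1 ` {..<b}"
  let ?B = "Leaf2 ` {..<d}"
  have "pverts (double_broom a b c d e) = ?P \<union> (?A \<union> ?B)"
    by (auto simp: double_broom_def)
  moreover have "card (?P \<union> (?A \<union> ?B)) = card ?P + card (?A \<union> ?B)"
    by (rule card_Un_disjoint) auto
  moreover have "card (?A \<union> ?B) = card ?A + card ?B"
    by (rule card_Un_disjoint) auto
  ultimately show ?thesis
    by (simp add: card_image inj_on_def)
qed

end

theory Submission
  imports Defs
begin

text \<open>
  Call a vertex high if its degree is at least \<open>k\<close>, and low otherwise; at least half of the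
  vertices are high. The tree \<open>C(a,b,c,d,e)\<close> embeds as soon as there is a path of length
  \<open>a + c + e\<close> whose vertices at positions \<open>a\<close> and \<open>a + c\<close> are high: the leaves are then added
  greedily, because at any moment at most \<open>k\<close> vertices of \<open>G\<close>, the centre among them, are in use.

  \<^emph>\<open>Reduction.\<close> Edges between low vertices can be deleted. One may pass to a component in which at
  least half of the vertices are high. If a set \<open>U\<close> of low vertices has at most \<open>|U|/2\<close>
  neighbours, deleting \<open>U\<close> spoils the degrees of at most \<open>|U|/2\<close> high vertices, so that still at
  least half of the remaining vertices are high. So the graph may be assumed to be connected,
  without edges between low vertices, and such that every nonempty set \<open>U\<close> of low vertices has more
  than \<open>|U|/2\<close> neighbours (\<open>spaced_path_exists\<close>).

  \<^emph>\<open>Core.\<close> Suppose that in such a graph a longest path has \<open>r \<le> k + 1\<close> vertices and that the ends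
  of all longest paths are low. This is impossible (\<open>no_short_extremal\<close>). Strip a longest path of its
  two ends. The remaining path \<open>P\<close> has two high ends, whose neighbours off \<open>P\<close> are low and have all
  their neighbours on \<open>P\<close>, each of these next to a low vertex of the longest path. There is no
  cycle of \<open>r - 2\<close> or \<open>r - 1\<close> vertices, by connectedness, by counting low vertices, and because no
  vertex has two pendant low neighbours. Hence the ends of \<open>P\<close>
  have together at most \<open>r - 3\<close> neighbours on \<open>P\<close>, so at least \<open>r + 1\<close> neighbours off \<open>P\<close>; and
  these form a set of low vertices with at most \<open>(r + 1)/2\<close> neighbours, which the reduction has
  excluded. As a longest path with at most \<open>k\<close> vertices always has low ends, there is a path
  with \<open>k\<close> edges (\<open>long_path\<close>).

  \<^emph>\<open>Alternation.\<close> Suppose that the desired path does not exist, and take any path with at least \<open>k\<close>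
  edges. It has so much room that, because of \<open>\<ell> \<ge> c\<close>, high and low vertices must alternate
  on it, with the exception of its first \<open>a\<close> and its last \<open>e\<close> vertices (\<open>alternates\<close>). For even \<open>c\<close>
  two vertices at distance \<open>c\<close> are then both high, which ends the proof. For the other case let
  \<open>a \<le> e\<close>. Since \<open>\<ell> + c \<ge> \<lfloor>n/2\<rfloor>\<close>, reading paths in both directions gives alternation except for the
  first and the last \<open>a\<close> vertices, and there are at most \<open>\<ell> + c \<le> k - 2a\<close> low vertices. By counting the
  neighbours of the first or the second vertex of a longest path, the longest paths have
  low ends and at most \<open>k + 1\<close> vertices, in contradiction to the core statement
  (\<open>no_dense_counterexample\<close>).
\<close>

section \<open>Paths and cycles in simple graphs\<close>

definition path_in :: "'a set \<Rightarrow> ('a \<Rightarrow> 'a \<Rightarrow> bool) \<Rightarrow> 'a list \<Rightarrow> bool" where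
  "path_in V E xs \<longleftrightarrow> xs \<noteq> [] \<and> distinct xs \<and> set xs \<subseteq> V \<and> successively E xs"

definition cycle_in :: "'a set \<Rightarrow> ('a \<Rightarrow> 'a \<Rightarrow> bool) \<Rightarrow> 'a list \<Rightarrow> bool" where
  "cycle_in V E xs \<longleftrightarrow> path_in V E xs \<and> E (last xs) (hd xs)"

definition degree_in :: "('a \<Rightarrow> 'a \<Rightarrow> bool) \<Rightarrow> 'a \<Rightarrow> nat" where
  "degree_in E v = card {w. E v w}"

definition high :: "'a set \<Rightarrow> ('a \<Rightarrow> 'a \<Rightarrow> bool) \<Rightarrow> nat \<Rightarrow> 'a set" where
  "high V E k = {v \<in> V. k \<le> degree_in E v}"

lemma path_in_single [simp]: "path_in V E [x] \<longleftrightarrow> x \<in> V"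
  by (auto simp: path_in_def)

lemma path_in_Nil [simp]: "\<not> path_in V E []"
  by (simp add: path_in_def)

lemma path_in_append:
  assumes "xs \<noteq> []" "ys \<noteq> []"
  shows "path_in V E (xs @ ys) \<longleftrightarrow>
    path_in V E xs \<and> path_in V E ys \<and> set xs \<inter> set ys = {} \<and> E (last xs) (hd ys)"
  using assms by (auto simp: path_in_def successively_append_iff)

lemma path_in_Cons:
  assumes "xs \<noteq> []"
  shows "path_in V E (x # xs) \<longleftrightarrow> x \<in> V \<and> x \<notin> set xs \<and> E x (hd xs) \<and> path_in V E xs"
  using path_in_append[of "[x]" xs V E] assms by auto

lemma path_in_nonempty: "path_in V E xs \<Longrightarrow> xs \<noteq> []"
  by (simp add: path_in_def)

lemma path_in_nth: "path_in V E xs \<Longrightarrow> Suc i < length xs \<Longrightarrow> E (xs ! i) (xs ! Suc i)"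
  by (auto simp: path_in_def successively_conv_nth)

lemma path_in_mono:
  assumes "path_in V E xs" "V \<subseteq> V'" "\<And>x y. E x y \<Longrightarrow> E' x y"
  shows "path_in V' E' xs"
  using assms by (auto simp: path_in_def intro: successively_mono)

lemma path_in_take_drop:
  assumes "path_in V E xs" "0 < i" "i < length xs"
  shows "path_in V E (take i xs)" "path_in V E (drop i xs)"
    "set (take i xs) \<inter> set (drop i xs) = {}"
  using path_in_append[of "take i xs" "drop i xs" V E] assms path_in_nonempty[OF assms(1)] by simp_all

lemma path_in_sublist:
  assumes "path_in V E xs" "0 < m" "t + m \<le> length xs"
  shows "path_in V E (take m (drop t xs))"
proof -
  have "path_in V E (drop t xs)"
    using assms path_in_take_drop(2)[of V E xs t] by (cases "t = 0") auto
  then show ?thesis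
    using assms path_in_take_drop(1)[of V E "drop t xs" m] by (cases "m = length xs - t") auto
qed

lemma last_take_nth: "0 < i \<Longrightarrow> i \<le> length xs \<Longrightarrow> last (take i xs) = xs ! (i - 1)"
  by (subst last_conv_nth) (auto simp: min_def)

lemma card_no_two_consecutive:
  fixes B :: "nat set"
  assumes "B \<subseteq> {p..<p + r}" "\<And>i. i \<in> B \<Longrightarrow> Suc i \<notin> B"
  shows "2 * card B \<le> r + 1"
proof -
  have fin: "finite B"
    using assms(1) finite_subset by blast
  have "B \<inter> Suc ` B = {}"
    using assms(2) by auto
  then have "card (B \<union> Suc ` B) = 2 * card B"
    using fin by (simp add: card_Un_disjoint card_image)
  moreover have "card (B \<union> Suc ` B) \<le> card {p..<p + r + 1}"
    using assms(1) by (intro card_mono) auto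
  ultimately show ?thesis by simp
qed

lemma card_nth_image:
  assumes "distinct xs" "I \<subseteq> {..<length xs}"
  shows "card ((!) xs ` I) = card I"
  using assms by (intro card_image inj_onI) (auto simp: nth_eq_iff_index_eq subset_iff)

locale simple_graph =
  fixes V :: "'a set" and E :: "'a \<Rightarrow> 'a \<Rightarrow> bool"
  assumes finite_V: "finite V"
    and sym: "E x y \<Longrightarrow> E y x"
    and irrefl: "\<not> E x x"
    and in_V: "E x y \<Longrightarrow> x \<in> V"
begin

lemma in_V': "E x y \<Longrightarrow> y \<in> V"
  using sym in_V by blast

lemma nbhd_subset: "{y. E x y} \<subseteq> V"
  using in_V' by blast

lemma finite_nbhd [simp]: "finite {y. E x y}"
  using nbhd_subset finite_V finite_subset by blast

lemma degree_in_mono: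
  assumes "\<And>x y. E' x y \<Longrightarrow> E x y"
  shows "degree_in E' v \<le> degree_in E v"
  unfolding degree_in_def using assms by (intro card_mono) auto

lemma path_rev [simp]: "path_in V E (rev xs) \<longleftrightarrow> path_in V E xs"
proof -
  have "successively (\<lambda>x y. E y x) xs = successively E xs"
    by (rule successively_cong) (use sym in blast)+
  then show ?thesis
    unfolding path_in_def successively_rev by simp
qed

lemma path_length: "path_in V E xs \<Longrightarrow> length xs \<le> card V"
  using finite_V by (metis card_mono distinct_card path_in_def)

lemma cycle_length: "cycle_in V E xs \<Longrightarrow> 2 \<le> length xs"
  using irrefl by (cases xs rule: remdups_adj.cases) (auto simp: cycle_in_def)

lemma cycle_rotate1: "cycle_in V E xs \<Longrightarrow> cycle_in V E (rotate1 xs)"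
proof -
  assume c: "cycle_in V E xs"
  then obtain x y ys where xs: "xs = x # y # ys"
    using cycle_length[OF c] by (cases xs rule: remdups_adj.cases) auto
  then show ?thesis
    using c path_in_append[of "y # ys" "[x]" V E] by (auto simp: cycle_in_def path_in_Cons)
qed

lemma cycle_rotate: "cycle_in V E xs \<Longrightarrow> cycle_in V E (rotate n xs)"
  by (induction n) (auto simp: cycle_rotate1)

lemma cycle_rotate_hd:
  assumes "cycle_in V E xs" "w \<in> set xs"
  obtains ys where "cycle_in V E ys" "hd ys = w" "set ys = set xs" "length ys = length xs"
proof -
  obtain i where "i < length xs" "xs ! i = w"
    using assms(2) by (auto simp: in_set_conv_nth)
  then have "hd (rotate i xs) = w"
    using assms(2) by (subst hd_rotate_conv_nth) auto
  then show ?thesis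
    using that[of "rotate i xs"] cycle_rotate[OF assms(1)] by simp
qed

lemma cycle_rotate_ends:
  assumes "cycle_in V E xs" "i < length xs"
  shows "hd (rotate (Suc i) xs) = xs ! (Suc i mod length xs)" "last (rotate (Suc i) xs) = xs ! i"
proof -
  have ne: "xs \<noteq> []"
    using assms(2) by auto
  show "hd (rotate (Suc i) xs) = xs ! (Suc i mod length xs)"
    using hd_rotate_conv_nth[OF ne] by blast
  have "last (rotate (Suc i) xs) = rotate (Suc i) xs ! (length xs - 1)"
    using ne by (subst last_conv_nth) auto
  also have "\<dots> = xs ! ((Suc i + (length xs - 1)) mod length xs)"
    using assms(2) by (subst nth_rotate) auto
  also have "Suc i + (length xs - 1) = i + length xs"
    using assms(2) by simp
  also have "(i + length xs) mod length xs = i"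
    using assms(2) by simp
  finally show "last (rotate (Suc i) xs) = xs ! i" .
qed

lemma cycle_Cons:
  assumes "path_in V E xs" "a \<in> V" "a \<notin> set xs" "E a (hd xs)" "E a (last xs)"
  shows "cycle_in V E (a # xs)"
  using assms sym by (auto simp: cycle_in_def path_in_Cons path_in_nonempty)

lemma path_insert:
  assumes "path_in V E xs" "path_in V E ys" "set xs \<inter> set ys = {}"
    "a \<notin> set xs" "a \<notin> set ys" "E a (last xs)" "E a (hd ys)"
  shows "path_in V E (xs @ a # ys)"
  using assms path_in_nonempty[OF assms(1)] path_in_nonempty[OF assms(2)] in_V[OF assms(6)] sym[OF assms(6)]
  by (auto simp: path_in_append path_in_Cons)

text \<open>
  The rotation of Posa: the initial segment before a neighbour of the first vertex is reversed. It
  yields a path on the same vertices with a new first vertex; the last two equations locate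
  the new edge, which is what the alternation arguments need.
\<close>

lemma posa_rotation:
  assumes "path_in V E xs" "0 < j" "j < length xs" "E (hd xs) (xs ! j)"
  shows "path_in V E (rev (take j xs) @ drop j xs)"
    "hd (rev (take j xs) @ drop j xs) = xs ! (j - 1)"
    "last (rev (take j xs) @ drop j xs) = last xs"
    "(rev (take j xs) @ drop j xs) ! (j - 1) = hd xs"
    "(rev (take j xs) @ drop j xs) ! j = xs ! j"
proof -
  have ne: "take j xs \<noteq> []" "drop j xs \<noteq> []"
    using assms(2,3) by auto
  show "path_in V E (rev (take j xs) @ drop j xs)"
    using path_in_take_drop[OF assms(1-3)] ne assms
    by (subst path_in_append) (auto simp: last_rev hd_drop_conv_nth)
  show "hd (rev (take j xs) @ drop j xs) = xs ! (j - 1)"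
    using ne assms(2,3) by (simp add: hd_append hd_rev last_take_nth)
  show "last (rev (take j xs) @ drop j xs) = last xs"
    using assms(3) by simp
  show "(rev (take j xs) @ drop j xs) ! (j - 1) = hd xs"
    using assms(2,3) ne by (auto simp: nth_append rev_nth hd_conv_nth)
  show "(rev (take j xs) @ drop j xs) ! j = xs ! j"
    using assms(2,3) by (auto simp: nth_append)
qed

lemma degree_split:
  "degree_in E v = card ({w. E v w} - A) + card ({w. E v w} \<inter> A)"
  unfolding degree_in_def
  by (metis Diff_Diff_Int card_Diff_subset_Int card_Int_Diff finite_nbhd finite_Int add.commute)

lemma card_nbrs_outside:
  assumes "distinct xs" "x \<in> set xs"
  shows "degree_in E x + 1 \<le> card ({w. E x w} - set xs) + length xs"
proof -
  have "{w. E x w} \<inter> set xs \<subseteq> set xs - {x}"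
    using irrefl by auto
  then have "card ({w. E x w} \<inter> set xs) \<le> card (set xs - {x})"
    by (intro card_mono) auto
  also have "\<dots> + 1 = length xs"
    using assms length_pos_if_in_set[OF assms(2)] by (simp add: card_Diff_singleton distinct_card)
  finally show ?thesis
    using degree_split[of x "set xs"] by linarith
qed

lemma extend_hd:
  assumes "path_in V E xs" "length xs \<le> degree_in E (hd xs)"
  obtains y where "y \<notin> set xs" "E (hd xs) y" "path_in V E (y # xs)"
proof -
  have "distinct xs" "hd xs \<in> set xs"
    using assms(1) by (auto simp: path_in_def)
  then have "card ({w. E (hd xs) w} - set xs) > 0"
    using card_nbrs_outside[of xs "hd xs"] assms(2) by linarith
  then obtain y where y: "y \<notin> set xs" "E (hd xs) y"
    by (auto simp: card_gt_0_iff)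
  moreover have "path_in V E (y # xs)"
    using y assms(1) in_V'[OF y(2)] sym[OF y(2)] path_in_nonempty[OF assms(1)] by (simp add: path_in_Cons)
  ultimately show ?thesis
    using that by blast
qed

text \<open>
  If the first vertex were adjacent to \<open>xs ! i\<close> and the last one to \<open>xs ! (i - 1)\<close>, these two edges
  would close the path up to a cycle on the same vertices. So every index \<open>i \<ge> 1\<close> is used by at
  most one of the two ends.
\<close>

lemma crossing:
  assumes P: "path_in V E xs"
    and no: "\<And>ys. cycle_in V E ys \<Longrightarrow> length ys \<noteq> length xs"
  shows "card ({w. E (hd xs) w} \<inter> set xs) + card ({w. E (last xs) w} \<inter> set xs) \<le> length xs - 1"
proof -
  let ?p = "length xs"
  define I where "I = {i. 1 \<le> i \<and> i < ?p \<and> E (hd xs) (xs ! i)}"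
  define J where "J = {i. 1 \<le> i \<and> i < ?p \<and> E (last xs) (xs ! (i - 1))}"
  have ne: "xs \<noteq> []"
    using P by (auto simp: path_in_def)
  have fin: "finite I" "finite J"
    by (auto simp: I_def J_def)
  have "I \<inter> J = {}"
  proof (rule ccontr)
    assume "I \<inter> J \<noteq> {}"
    then obtain i where i: "1 \<le> i" "i < ?p" "E (hd xs) (xs ! i)" "E (last xs) (xs ! (i - 1))"
      by (auto simp: I_def J_def)
    have "cycle_in V E (take i xs @ rev (drop i xs))"
      using i path_in_take_drop[OF P, of i] sym
      by (auto simp: cycle_in_def path_in_append last_take_nth hd_rev last_rev hd_append hd_drop_conv_nth)
    then show False
      using no[of "take i xs @ rev (drop i xs)"] i by auto
  qed
  then have "card I + card J = card (I \<union> J)"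
    using fin by (simp add: card_Un_disjoint)
  also have "\<dots> \<le> card {1..<?p}"
    by (intro card_mono) (auto simp: I_def J_def)
  finally have *: "card I + card J \<le> ?p - 1"
    by simp
  have "{w. E (hd xs) w} \<inter> set xs \<subseteq> (!) xs ` I"
  proof
    fix w assume w: "w \<in> {w. E (hd xs) w} \<inter> set xs"
    then obtain i where i: "i < ?p" "xs ! i = w"
      by (auto simp: in_set_conv_nth)
    have "i \<noteq> 0"
      using w i irrefl hd_conv_nth[OF ne] by (cases i) auto
    then have "i \<in> I"
      using i w by (auto simp: I_def)
    then show "w \<in> (!) xs ` I"
      using i by blast
  qed
  then have 1: "card ({w. E (hd xs) w} \<inter> set xs) \<le> card I"
    using fin by (meson card_image_le card_mono finite_imageI le_trans)
  have "{w. E (last xs) w} \<inter> set xs \<subseteq> (\<lambda>i. xs ! (i - 1)) ` J"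
  proof
    fix w assume w: "w \<in> {w. E (last xs) w} \<inter> set xs"
    then obtain i where i: "i < ?p" "xs ! i = w"
      by (auto simp: in_set_conv_nth)
    have "i \<noteq> ?p - 1"
      using w i irrefl last_conv_nth[OF ne] by auto
    then have "Suc i \<in> J"
      using i w by (auto simp: J_def)
    then show "w \<in> (\<lambda>i. xs ! (i - 1)) ` J"
      using i by force
  qed
  then have 2: "card ({w. E (last xs) w} \<inter> set xs) \<le> card J"
    using fin by (meson card_image_le card_mono finite_imageI le_trans)
  show ?thesis
    using * 1 2 by linarith
qed

end

section \<open>Reduced graphs\<close>

text \<open>
  The properties that a graph can be assumed to have in a search for paths with prescribed
  high vertices: a smallest graph without such a path has them, once the edges between low
  vertices are removed (\<open>spaced_path_exists\<close>).
\<close>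

locale reduced_graph = simple_graph +
  fixes k :: nat
  assumes V_nonempty: "V \<noteq> {}"
    and half: "card V \<le> 2 * card (high V E k)"
    and indep: "E x y \<Longrightarrow> x \<in> high V E k \<or> y \<in> high V E k"
    and connected: "K \<subseteq> V \<Longrightarrow> K \<noteq> {} \<Longrightarrow> (\<And>x y. x \<in> K \<Longrightarrow> E x y \<Longrightarrow> y \<in> K) \<Longrightarrow> K = V"
    and expansion: "U \<subseteq> V - high V E k \<Longrightarrow> U \<noteq> {} \<Longrightarrow> card U < 2 * card {w. \<exists>u\<in>U. E u w}"
begin

abbreviation L :: "'a set" where "L \<equiv> high V E k"

lemma L_subset: "L \<subseteq> V"
  by (auto simp: high_def)

lemma finite_L [simp]: "finite L"
  using L_subset finite_V finite_subset by blast

lemma L_degree: "v \<in> L \<Longrightarrow> k \<le> degree_in E v"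
  by (auto simp: high_def)

lemma indep': "E x y \<Longrightarrow> x \<notin> L \<Longrightarrow> y \<in> L"
  using indep by blast

lemma L_nonempty: "L \<noteq> {}"
proof
  assume "L = {}"
  then have "card V = 0"
    using half by simp
  then show False
    using V_nonempty finite_V by simp
qed

lemma card_V_gt: "k < card V"
proof -
  obtain v where v: "v \<in> L"
    using L_nonempty by blast
  have "degree_in E v \<le> card (V - {v})"
    unfolding degree_in_def using nbhd_subset irrefl finite_V by (intro card_mono) auto
  also have "\<dots> < card V"
    using v L_subset finite_V by (intro psubset_card_mono) auto
  finally show ?thesis
    using L_degree[OF v] by simp
qed

lemma card_low: "card (V - L) \<le> card V div 2"
  using half card_Diff_subset[OF finite_L L_subset] by linarith

text \<open>
  If no high vertex off the cycle is within distance two of it through vertices off the cycle, the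
  cycle and its neighbours are closed under adjacency, hence everything; and the neighbours off
  the cycle are low.
\<close>

lemma cycle_covers_high:
  assumes C: "cycle_in V E xs"
    and A: "\<And>w z. w \<in> set xs \<Longrightarrow> E w z \<Longrightarrow> z \<in> L \<Longrightarrow> z \<in> set xs"
    and B: "\<And>w s z. w \<in> set xs \<Longrightarrow> E w s \<Longrightarrow> s \<notin> set xs \<Longrightarrow> E s z \<Longrightarrow> z \<in> L \<Longrightarrow> z \<in> set xs"
  shows "L \<subseteq> set xs"
proof -
  let ?K = "set xs \<union> {s. \<exists>w\<in>set xs. E w s}"
  have "?K = V"
  proof (rule connected)
    show "?K \<subseteq> V"
      using C in_V' by (auto simp: cycle_in_def path_in_def)
    show "?K \<noteq> {}"
      using C by (auto simp: cycle_in_def path_in_def)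
    fix x y assume x: "x \<in> ?K" and xy: "E x y"
    show "y \<in> ?K"
    proof (cases "x \<in> set xs")
      case False
      then obtain w where w: "w \<in> set xs" "E w x"
        using x by blast
      then have "x \<notin> L"
        using A False by blast
      then show ?thesis
        using indep' xy B w False by blast
    qed (use xy in blast)
  qed
  then show ?thesis
    using A L_subset by blast
qed

text \<open>
  On the cycle, every high vertex whose successor is low is paired with that successor. So the low
  vertices on the cycle are at least as many as the high vertices without a high successor; as at
  least half of all vertices are high, what is missing from the cycle is compensated by high
  vertices with a high successor.
\<close>

lemma cycle_count:
  assumes C: "cycle_in V E xs" and L: "L \<subseteq> set xs"
  shows "card V \<le> length xs + card {i. i < length xs \<and> xs ! i \<in> L \<and> xs ! (Suc i mod length xs) \<in> L}"
proof -
  let ?g = "length xs"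
  define A where "A = {i. i < ?g \<and> xs ! i \<in> L}"
  define B where "B = {i. i < ?g \<and> xs ! i \<notin> L}"
  define N where "N = {i. i < ?g \<and> xs ! i \<in> L \<and> xs ! (Suc i mod ?g) \<in> L}"
  have fin: "finite A" "finite B" "finite N"
    by (auto simp: A_def B_def N_def)
  have g: "0 < ?g"
    using cycle_length[OF C] by linarith
  have "distinct xs"
    using C by (auto simp: cycle_in_def path_in_def)
  then have "card ((!) xs ` A) = card A"
    by (rule card_nth_image) (auto simp: A_def)
  moreover have "(!) xs ` A = L"
    using L by (auto simp: A_def in_set_conv_nth subset_iff image_iff)
  ultimately have cA: "card A = card L"
    by simp
  have "card A + card B = card (A \<union> B)"
    using fin by (intro card_Un_disjoint[symmetric]) (auto simp: A_def B_def)
  also have "A \<union> B = {..<?g}"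
    by (auto simp: A_def B_def)
  finally have AB: "card A + card B = ?g"
    by simp
  have inj: "inj_on (\<lambda>i. Suc i mod ?g) (A - N)"
    by (auto simp: inj_on_def mod_Suc A_def split: if_splits)
  have "(\<lambda>i. Suc i mod ?g) ` (A - N) \<subseteq> B"
    using g by (auto simp: A_def B_def N_def)
  then have "card (A - N) \<le> card B"
    using card_inj_on_le[OF inj _ fin(2)] by blast
  moreover have "card (A - N) = card A - card N"
    using fin by (intro card_Diff_subset) (auto simp: A_def N_def)
  ultimately show ?thesis
    using half cA AB unfolding N_def by linarith
qed

end

section \<open>Longest paths with low ends\<close>

locale extremal_graph = reduced_graph +
  fixes r :: nat
  assumes path_max: "path_in V E xs \<Longrightarrow> length xs \<le> r"
    and path_ends: "path_in V E xs \<Longrightarrow> length xs = r \<Longrightarrow> hd xs \<notin> L"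
    and path_ex: "\<exists>xs. path_in V E xs \<and> length xs = r"
begin

lemma path_ends': "path_in V E xs \<Longrightarrow> length xs = r \<Longrightarrow> last xs \<notin> L"
  using path_ends[of "rev xs"] by (auto simp: hd_rev)

text \<open>
  A high vertex at distance one from a cycle of \<open>r - 1\<close> vertices would give a longest path
  with a high end, and one at distance two a path that is too long.
\<close>

lemma cycle_missing_one_covers_high:
  assumes C: "cycle_in V E xs" and len: "length xs + 1 = r"
  shows "L \<subseteq> set xs"
proof (rule cycle_covers_high[OF C])
  fix w z assume wz: "w \<in> set xs" "E w z" "z \<in> L"
  show "z \<in> set xs"
  proof (rule ccontr)
    assume z: "z \<notin> set xs"
    obtain ys where ys: "cycle_in V E ys" "hd ys = w" "set ys = set xs" "length ys = length xs"
      using cycle_rotate_hd[OF C wz(1)] .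
    then have "path_in V E (z # ys)"
      using wz z sym in_V' by (auto simp: cycle_in_def path_in_Cons path_in_nonempty)
    then show False
      using path_ends[of "z # ys"] wz ys len by simp
  qed
next
  fix w s z assume *: "w \<in> set xs" "E w s" "s \<notin> set xs" "E s z" "z \<in> L"
  show "z \<in> set xs"
  proof (rule ccontr)
    assume z: "z \<notin> set xs"
    obtain ys where ys: "cycle_in V E ys" "hd ys = w" "set ys = set xs" "length ys = length xs"
      using cycle_rotate_hd[OF C *(1)] .
    then have "path_in V E (z # s # ys)"
      using * z sym in_V' irrefl by (auto simp: cycle_in_def path_in_Cons path_in_nonempty)
    then show False
      using path_max[of "z # s # ys"] ys len by simp
  qed
qed

end

text \<open>
  The bound on \<open>r\<close> makes a high end of a path with at most \<open>r - 1\<close> vertices extensible.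
\<close>

locale short_extremal_graph = extremal_graph +
  assumes short: "r \<le> k + 1"
begin

text \<open>
  With two high ends, the path could be extended at one end to a longest path that keeps the
  other, high, end.
\<close>

lemma no_high_ended:
  assumes P: "path_in V E xs" and len: "length xs + 1 = r" and hd: "hd xs \<in> L"
  shows "last xs \<notin> L"
proof -
  have "length xs \<le> degree_in E (hd xs)"
    using L_degree[OF hd] len short by simp
  then obtain y where "path_in V E (y # xs)"
    using extend_hd[OF P] by blast
  then show ?thesis
    using path_ends'[of "y # xs"] len path_in_nonempty[OF P] by simp
qed

text \<open>
  The cycle contains all high vertices but not all vertices, so two high vertices are
  consecutive on it. Cut between them, it becomes a path with two high ends.
\<close>

lemma no_cycle_missing_one:
  assumes C: "cycle_in V E xs"
  shows "length xs + 1 \<noteq> r"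
proof
  assume len: "length xs + 1 = r"
  define N where "N = {i. i < length xs \<and> xs ! i \<in> L \<and> xs ! (Suc i mod length xs) \<in> L}"
  have "card V \<le> length xs + card N"
    unfolding N_def using cycle_count[OF C cycle_missing_one_covers_high[OF C len]] .
  then have "card N \<noteq> 0"
    using card_V_gt short len by linarith
  then obtain i where i: "i < length xs" "xs ! i \<in> L" "xs ! (Suc i mod length xs) \<in> L"
    by (metis (mono_tags, lifting) N_def card.empty ex_in_conv mem_Collect_eq)
  have "path_in V E (rotate (Suc i) xs)"
    using cycle_rotate[OF C] by (simp add: cycle_in_def del: rotate_Suc)
  then show False
    using no_high_ended[of "rotate (Suc i) xs"] cycle_rotate_ends[OF C i(1)] i len
    by (simp del: rotate_Suc)
qed

text \<open>
  A high vertex \<open>z\<close> attached to the cycle would have at least two neighbours off the cycle, all of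
  which could only be adjacent to \<open>z\<close>. Two pendant vertices at the same vertex violate the
  expansion property.
\<close>

lemma no_high_nbr_of_cycle_missing_two:
  assumes C: "cycle_in V E xs" and len: "length xs + 2 = r"
    and zw: "z \<in> L" "z \<notin> set xs" "E z w" "w \<in> set xs"
  shows False
proof -
  have rot: "\<exists>ys. cycle_in V E ys \<and> hd ys = w \<and> set ys = set xs \<and> length ys = length xs"
    if "w \<in> set xs" for w
    using cycle_rotate_hd[OF C that] by metis
  \<comment> \<open>After attaching z, the cycle is a path of r - 1 vertices with the high end z, so the vertex
     on the cycle before any neighbour of z is low.\<close>
  have step: "last ys \<notin> L \<and> path_in V E (z # ys)"
    if "cycle_in V E ys" "set ys = set xs" "length ys = length xs" "E z (hd ys)" for ys
  proof -
    have ne: "ys \<noteq> []"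
      using that(1) by (auto simp: cycle_in_def path_in_def)
    have "path_in V E (z # ys)"
      using that(1,2,4) zw(2) in_V[OF zw(3)] ne by (simp add: cycle_in_def path_in_Cons)
    then show ?thesis
      using no_high_ended[of "z # ys"] that(3) len zw(1) ne by simp
  qed
  obtain ys where ys: "cycle_in V E ys" "hd ys = w" "set ys = set xs" "length ys = length xs"
    using rot zw by blast
  have lst: "last ys \<notin> L" and pz: "path_in V E (z # ys)"
    using step[OF ys(1,3,4)] ys(2) zw(3) by simp_all
  have ne: "ys \<noteq> []"
    using ys(1) by (auto simp: cycle_in_def path_in_def)
  \<comment> \<open>The predecessor of a neighbour of z is no neighbour of z, as its own predecessor would be
     another low vertex. This saves the one neighbour needed for two neighbours off the cycle.\<close>
  have lst': "\<not> E z (last ys)"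
  proof
    assume zl: "E z (last ys)"
    obtain us where us: "cycle_in V E us" "hd us = last ys" "set us = set xs" "length us = length xs"
      using rot[of "last ys"] last_in_set[OF ne] unfolding ys(3) by blast
    then have "last us \<notin> L"
      using step[OF us(1,3,4)] us(2) zl by simp
    then show False
      using us(1,2) lst indep[of "last us" "hd us"] by (simp add: cycle_in_def)
  qed
  define U where "U = {s. E z s} - set xs"
  have "{s. E z s} \<inter> set xs \<subseteq> set xs - {last ys}"
    using lst' by auto
  then have "card ({s. E z s} \<inter> set xs) \<le> card (set xs - {last ys})"
    by (intro card_mono) auto
  also have "\<dots> = length xs - 1"
    using last_in_set[OF ne] C unfolding ys(3)
    by (simp add: card_Diff_singleton distinct_card cycle_in_def path_in_def)
  finally have "card U \<ge> 2"
    using degree_split[of z "set xs"] L_degree[OF zw(1)] len short cycle_length[OF C]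
    unfolding U_def by linarith
  have Us: "s \<notin> L \<and> (\<forall>v. E s v \<longrightarrow> v = z)" if s: "s \<in> U" for s
  proof -
    have sz: "E z s" "s \<notin> set xs" "s \<noteq> z"
      using s irrefl by (auto simp: U_def)
    have ps: "path_in V E (s # z # ys)"
      using sz pz ys(3) sym[OF sz(1)] in_V'[OF sz(1)] by (simp add: path_in_Cons)
    then have sL: "s \<notin> L"
      using path_ends[of "s # z # ys"] ys(4) len by simp
    have "v = z" if sv: "E s v" for v
    proof (rule ccontr)
      assume vz: "v \<noteq> z"
      have vL: "v \<in> L"
        using indep' sv sL by blast
      show False
      proof (cases "v \<in> set xs")
        case True
        then obtain us where us: "cycle_in V E us" "hd us = v" "set us = set xs" "length us = length xs"
          using rot by blast
        then have "path_in V E (z # s # us)"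
          using sz sv zw(1,2) in_V'[OF sz(1)] in_V[OF sz(1)] path_in_nonempty[of V E us]
          by (simp add: path_in_Cons cycle_in_def)
        then show False
          using path_ends[of "z # s # us"] us(4) len zw(1) by simp
      next
        case False
        then have "path_in V E (v # s # z # ys)"
          using ps vz ys(3) sym[OF sv] in_V'[OF sv] irrefl[of s] sv by (auto simp: path_in_Cons)
        then show False
          using path_max[of "v # s # z # ys"] ys(4) len by simp
      qed
    qed
    then show ?thesis
      using sL by blast
  qed
  have "U \<noteq> {}"
    using \<open>card U \<ge> 2\<close> by auto
  have "{w. \<exists>u\<in>U. E u w} \<subseteq> {z}"
    using Us by blast
  then have "card {w. \<exists>u\<in>U. E u w} \<le> 1"
    using card_mono[of "{z}"] by fastforce
  moreover have "U \<subseteq> V - L"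
    using Us in_V' unfolding U_def by blast
  ultimately show False
    using expansion[of U] \<open>U \<noteq> {}\<close> \<open>card U \<ge> 2\<close> by linarith
qed

lemma cycle_missing_two_covers_high:
  assumes C: "cycle_in V E xs" and len: "length xs + 2 = r"
  shows "L \<subseteq> set xs"
proof (rule cycle_covers_high[OF C])
  show "z \<in> set xs" if "w \<in> set xs" "E w z" "z \<in> L" for w z
    using no_high_nbr_of_cycle_missing_two[OF C len that(3) _ sym[OF that(2)] that(1)] by blast
next
  fix w s z assume *: "w \<in> set xs" "E w s" "s \<notin> set xs" "E s z" "z \<in> L"
  show "z \<in> set xs"
  proof (rule ccontr)
    assume z: "z \<notin> set xs"
    obtain ys where ys: "cycle_in V E ys" "hd ys = w" "set ys = set xs" "length ys = length xs"
      using cycle_rotate_hd[OF C *(1)] .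
    have "s \<noteq> z" and ne: "ys \<noteq> []"
      using *(4) irrefl ys(1) by (auto simp: cycle_in_def path_in_def)
    then have "path_in V E (z # s # ys)"
      using ys(1,2,3) *(3) z sym[OF *(2)] sym[OF *(4)] in_V'[OF *(2)] in_V'[OF *(4)]
      by (simp add: cycle_in_def path_in_Cons)
    then show False
      using path_ends[of "z # s # ys"] *(5) ys(4) len by simp
  qed
qed

text \<open>
  All high vertices lie on the cycle and each of them has at least two neighbours off the cycle. Two
  high vertices with high successors have no common neighbour \<open>s\<close> off the cycle: going from
  one successor along the cycle to the other vertex, through \<open>s\<close>, and back along the cycle to the
  other successor gives a path of \<open>r - 1\<close> vertices with two high ends. So there are at least
  twice as many vertices off the cycle as high vertices with high successor. By
  \<open>cycle_count\<close> both numbers are zero, but then the neighbours off the cycle do not exist.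
\<close>

lemma no_cycle_missing_two:
  assumes C: "cycle_in V E xs"
  shows "length xs + 2 \<noteq> r"
proof
  assume len: "length xs + 2 = r"
  note L = cycle_missing_two_covers_high[OF C len]
  define N where "N = {i. i < length xs \<and> xs ! i \<in> L \<and> xs ! (Suc i mod length xs) \<in> L}"
  define Off where "Off i = {s. E (xs ! i) s} - set xs" for i
  have finN: "finite N"
    by (auto simp: N_def)
  have dist: "distinct xs" and sub: "set xs \<subseteq> V"
    using C by (auto simp: cycle_in_def path_in_def)
  have O2: "card (Off i) \<ge> 2" if "i < length xs" "xs ! i \<in> L" for i
  proof -
    have "degree_in E (xs ! i) + 1 \<le> card (Off i) + length xs"
      unfolding Off_def using dist that(1) by (intro card_nbrs_outside) auto
    then show ?thesis
      using L_degree[OF that(2)] len short by linarith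
  qed
  have disj: "Off i \<inter> Off j = {}" if ij: "i \<in> N" "j \<in> N" "i < j" for i j
  proof (rule ccontr)
    assume "Off i \<inter> Off j \<noteq> {}"
    then obtain s where s: "s \<notin> set xs" "E (xs ! i) s" "E (xs ! j) s"
      by (auto simp: Off_def)
    define ys where "ys = rotate (Suc i) xs"
    have ys: "cycle_in V E ys" "set ys = set xs" "length ys = length xs"
      using cycle_rotate[OF C] by (simp_all add: ys_def del: rotate_Suc)
    have ends: "hd ys = xs ! (Suc i mod length xs)" "last ys = xs ! i"
      using cycle_rotate_ends[OF C] ij by (simp_all add: ys_def N_def del: rotate_Suc)
    have pys: "path_in V E ys"
      using ys by (simp add: cycle_in_def)
    define t where "t = j - i"
    have t: "0 < t" "t < length ys"
      using ij by (auto simp: t_def N_def ys)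
    have "ys ! m = xs ! ((Suc i + m) mod length xs)" if "m < length ys" for m
      using that nth_rotate[of m xs "Suc i"] by (simp add: ys_def del: rotate_Suc)
    from this[of "t - 1"] this[of t]
    have nth: "ys ! (t - 1) = xs ! j" "ys ! t = xs ! (Suc j mod length xs)"
      using ij t by (simp_all add: t_def N_def)
    have "path_in V E (take t ys @ s # rev (drop t ys))"
    proof (rule path_insert)
      show "path_in V E (take t ys)" "path_in V E (rev (drop t ys))"
        "set (take t ys) \<inter> set (rev (drop t ys)) = {}"
        using path_in_take_drop[OF pys t] by simp_all
      show "s \<notin> set (take t ys)" "s \<notin> set (rev (drop t ys))"
        using s(1) ys(2) by (auto dest: in_set_takeD in_set_dropD)
      show "E s (last (take t ys))" "E s (hd (rev (drop t ys)))"
        using t nth ends sym[OF s(2)] sym[OF s(3)] by (simp_all add: last_take_nth hd_rev)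
    qed
    moreover have "hd (take t ys @ s # rev (drop t ys)) \<in> L"
      using ends ij t path_in_nonempty[OF pys] by (simp add: hd_append N_def)
    moreover have "last (take t ys @ s # rev (drop t ys)) \<in> L"
      using nth ij t by (simp add: last_rev hd_drop_conv_nth N_def)
    moreover have "length (take t ys @ s # rev (drop t ys)) + 1 = r"
      using t ys len by simp
    ultimately show False
      using no_high_ended by blast
  qed
  have "2 * card N \<le> (\<Sum>i\<in>N. card (Off i))"
    using O2 sum_bounded_below[of N 2 "\<lambda>i. card (Off i)"] by (auto simp: N_def)
  also have "\<dots> = card (\<Union>i\<in>N. Off i)"
  proof (rule card_UN_disjoint[symmetric])
    show "\<forall>i\<in>N. \<forall>j\<in>N. i \<noteq> j \<longrightarrow> Off i \<inter> Off j = {}"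
      using disj by (metis Int_commute linorder_neqE_nat)
  qed (use finN in \<open>auto simp: Off_def\<close>)
  also have "\<dots> \<le> card (V - set xs)"
    using finite_V in_V' by (intro card_mono) (auto simp: Off_def)
  also have "\<dots> = card V - length xs"
    using dist sub by (simp add: card_Diff_subset distinct_card)
  also have "\<dots> \<le> card N"
    using cycle_count[OF C L] unfolding N_def by simp
  finally have "card N = 0"
    by simp
  then have "card V \<le> length xs"
    using cycle_count[OF C L] unfolding N_def by linarith
  then have "V = set xs"
    using dist sub finite_V by (metis card_seteq distinct_card)
  moreover obtain i where "i < length xs" "xs ! i \<in> L"
    using L L_nonempty by (metis ex_in_conv in_set_conv_nth subset_iff)
  ultimately have "Off i = {}" "card (Off i) \<ge> 2"
    using O2 in_V' by (auto simp: Off_def)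
  then show False
    by simp
qed

text \<open>
  Here \<open>P\<close> is a longest path without its two ends, and \<open>a\<close> can replace the first end. The last claim is
  again a rotation: inserting \<open>a\<close> at \<open>P ! i\<close> gives a path of \<open>r - 1\<close> vertices from \<open>P ! (i - 1)\<close> to the
  high last vertex of \<open>P\<close>.
\<close>

lemma nbrs_in_middle:
  assumes P: "path_in V E P" and len: "length P + 2 = r" and ends: "hd P \<in> L" "last P \<in> L"
    and a: "E (hd P) a" "a \<notin> set P"
  shows "a \<notin> L" "E a z \<Longrightarrow> z \<in> set P"
    "\<lbrakk>E a (P ! i); 0 < i; i < length P\<rbrakk> \<Longrightarrow> P ! (i - 1) \<notin> L"
proof -
  have ne: "P \<noteq> []"
    using P by (auto simp: path_in_def)
  have aP: "path_in V E (a # P)"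
    using P a(2) ne sym[OF a(1)] in_V'[OF a(1)] by (simp add: path_in_Cons)
  show aL: "a \<notin> L"
    using no_high_ended[OF aP] len ends ne by auto
  show "z \<in> set P" if z: "E a z"
  proof (rule ccontr)
    assume "z \<notin> set P"
    moreover have "z \<noteq> a"
      using z irrefl by auto
    ultimately have "path_in V E (z # a # P)"
      using aP sym[OF z] in_V'[OF z] by (simp add: path_in_Cons)
    then show False
      using path_ends[of "z # a # P"] len indep'[OF z aL] by simp
  qed
  show "P ! (i - 1) \<notin> L" if i: "E a (P ! i)" "0 < i" "i < length P"
  proof
    assume h: "P ! (i - 1) \<in> L"
    have "path_in V E (rev (take i P) @ a # drop i P)"
    proof (rule path_insert)
      show "path_in V E (rev (take i P))" "path_in V E (drop i P)"
        "set (rev (take i P)) \<inter> set (drop i P) = {}"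
        using path_in_take_drop[OF P i(2,3)] by simp_all
      show "a \<notin> set (rev (take i P))" "a \<notin> set (drop i P)"
        using a(2) by (auto dest: in_set_takeD in_set_dropD)
      show "E a (last (rev (take i P)))" "E a (hd (drop i P))"
        using i ne sym[OF a(1)] by (simp_all add: last_rev hd_drop_conv_nth)
    qed
    moreover have "hd (rev (take i P) @ a # drop i P) \<in> L"
      using h i ne by (simp add: hd_append hd_rev last_take_nth)
    moreover have "last (rev (take i P) @ a # drop i P) \<in> L"
      using ends i by simp
    ultimately show False
      using no_high_ended[of "rev (take i P) @ a # drop i P"] len i by simp
  qed
qed

text \<open>
  For \<open>r = 3\<close> the middle vertex of a longest path has two pendant neighbours, against expansion.
  The bound ensures that a longest path without its ends still has two different ends.
\<close>

lemma r_ge_4: "4 \<le> r"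
proof -
  obtain xs where xs: "path_in V E xs" "length xs = r"
    using path_ex by blast
  have ends: "hd xs \<notin> L" "last xs \<notin> L"
    using xs path_ends path_ends' by auto
  obtain v where v: "v \<in> L"
    using L_nonempty by blast
  have "r \<noteq> 0"
    using xs path_in_nonempty[OF xs(1)] by auto
  moreover have "r \<noteq> 1"
    using path_ends[of "[v]"] v L_subset by auto
  moreover have "r \<noteq> 2"
  proof
    assume "r = 2"
    then obtain x y where "xs = [x, y]"
      using xs(2) by (auto simp: numeral_2_eq_2 length_Suc_conv)
    then show False
      using xs ends indep[of x y] by (simp add: path_in_Cons)
  qed
  moreover have "r \<noteq> 3"
  proof
    assume r: "r = 3"
    then obtain x y z where xyz: "xs = [x, y, z]"
      using xs(2) by (auto simp: numeral_3_eq_3 length_Suc_conv)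
    then have y: "E x y" "E y z" "y \<in> L"
      using xs ends indep[of x y] by (auto simp: path_in_Cons)
    define U where "U = {w. E y w}"
    have Us: "u \<notin> L \<and> (\<forall>w. E u w \<longrightarrow> w = y)" if "u \<in> U" for u
    proof -
      have "path_in V E [y]" "length [y] + 2 = r" "hd [y] \<in> L" "last [y] \<in> L"
        "E (hd [y]) u" "u \<notin> set [y]"
        using y r L_subset that irrefl[of y] by (auto simp: U_def)
      from nbrs_in_middle(1,2)[OF this] show ?thesis
        by auto
    qed
    have "card U \<ge> 2"
      using L_degree[OF y(3)] short r by (simp add: U_def degree_in_def)
    moreover have "U \<noteq> {}"
      using y by (auto simp: U_def)
    moreover have "{w. \<exists>u\<in>U. E u w} \<subseteq> {y}"
      using Us by blast
    then have "card {w. \<exists>u\<in>U. E u w} \<le> 1"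
      using card_mono[of "{y}" "{w. \<exists>u\<in>U. E u w}"] by simp
    moreover have "U \<subseteq> V - L"
      using Us in_V' unfolding U_def by blast
    ultimately show False
      using expansion[of U] by linarith
  qed
  ultimately show ?thesis
    by linarith
qed

text \<open>
  Let \<open>A\<close> and \<open>B\<close> be the neighbours off \<open>P\<close> of the two ends of \<open>P\<close>. A neighbour of \<open>A\<close> is preceded by
  a low vertex on the path \<open>Q\<close>, a neighbour of \<open>B\<close> is followed by one, and no low vertex serves for both
  purposes, since otherwise there would be a cycle of \<open>r - 1\<close> vertices. As at most \<open>(r + 1)/2\<close>
  vertices of \<open>Q\<close> are low, \<open>A \<union> B\<close> has too few neighbours.
\<close>

theorem no_short_extremal: False
proof -
  obtain Q where Q: "path_in V E Q" "length Q = r"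
    using path_ex by blast
  have Q_ends: "hd Q \<notin> L" "last Q \<notin> L"
    using Q path_ends path_ends' by auto
  define P where "P = take (r - 2) (drop 1 Q)"
  define p where "p = length P"
  have lenP: "p + 2 = r" and p2: "2 \<le> p"
    using Q r_ge_4 by (auto simp: P_def p_def)
  have P: "path_in V E P"
    unfolding P_def using Q r_ge_4 by (intro path_in_sublist) auto
  have PQ: "P ! i = Q ! Suc i" if "i < p" for i
    using that Q(2) r_ge_4 by (simp add: P_def p_def)
  have ne: "P \<noteq> []" "Q \<noteq> []"
    using p2 P Q by (auto simp: path_in_def)
  have distP: "distinct P"
    using P by (auto simp: path_in_def)
  have Q_edge: "E (Q ! i) (Q ! Suc i)" if "Suc i < r" for i
    using path_in_nth Q that by metis
  have hdP: "hd P = Q ! 1" and lastP: "last P = Q ! p"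
    using PQ[of 0] PQ[of "p - 1"] p2 ne by (simp_all add: hd_conv_nth last_conv_nth p_def)
  have Q0: "Q ! 0 \<notin> L" "Q ! Suc p \<notin> L"
  proof -
    have "length Q - 1 = Suc p"
      using Q(2) lenP by simp
    then show "Q ! 0 \<notin> L" "Q ! Suc p \<notin> L"
      using Q_ends ne by (simp_all add: hd_conv_nth last_conv_nth)
  qed
  have ends: "hd P \<in> L" "last P \<in> L"
    using Q_edge[of 0] Q_edge[of p] Q0 lenP p2 indep hdP lastP by auto
  have no2: "length ys \<noteq> p" if "cycle_in V E ys" for ys
    using no_cycle_missing_two[OF that] lenP by simp
  define A where "A = {w. E (hd P) w} - set P"
  define B where "B = {w. E (last P) w} - set P"
  have fin: "finite A" "finite B"
    by (auto simp: A_def B_def)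
  have "card A + card B + (p - 1) \<ge> 2 * k"
  proof -
    have "card ({w. E (hd P) w} \<inter> set P) + card ({w. E (last P) w} \<inter> set P) \<le> p - 1"
      unfolding p_def using no2 p_def by (intro crossing[OF P]) blast
    then show ?thesis
      using degree_split[of "hd P" "set P"] degree_split[of "last P" "set P"]
        L_degree[OF ends(1)] L_degree[OF ends(2)] unfolding A_def B_def by linarith
  qed
  then have AB: "card A + card B \<ge> r + 1"
    using short lenP p2 by linarith
  have disj: "A \<inter> B = {}"
  proof (rule ccontr)
    assume "A \<inter> B \<noteq> {}"
    then obtain a where "E (hd P) a" "E (last P) a" "a \<notin> set P"
      by (auto simp: A_def B_def)
    then have "cycle_in V E (a # P)"
      using P in_V'[of "hd P" a] sym by (intro cycle_Cons) blast+
    then show False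
      using no_cycle_missing_one[of "a # P"] lenP by (simp add: p_def)
  qed
  have lenP': "length P + 2 = r"
    using lenP by (simp add: p_def)
  have A: "a \<notin> L" "E a z \<Longrightarrow> z \<in> set P"
    "\<lbrakk>E a (P ! i); 0 < i; i < p\<rbrakk> \<Longrightarrow> P ! (i - 1) \<notin> L" if "a \<in> A" for a z i
    using nbrs_in_middle[OF P lenP' ends, of a] that unfolding A_def p_def by blast+
  have revP: "path_in V E (rev P)" "length (rev P) + 2 = r" "hd (rev P) \<in> L" "last (rev P) \<in> L"
    using P lenP' ends ne by (auto simp: hd_rev last_rev)
  have B: "b \<notin> L" "E b z \<Longrightarrow> z \<in> set P"
    "\<lbrakk>E b (P ! i); Suc i < p\<rbrakk> \<Longrightarrow> P ! Suc i \<notin> L" if b: "b \<in> B" for b z i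
  proof -
    have b': "E (hd (rev P)) b" "b \<notin> set (rev P)"
      using b ne by (auto simp: B_def hd_rev)
    show "b \<notin> L" "E b z \<Longrightarrow> z \<in> set P"
      using nbrs_in_middle(1,2)[OF revP b'] by auto
    assume i: "E b (P ! i)" "Suc i < p"
    then show "P ! Suc i \<notin> L"
      using nbrs_in_middle(3)[OF revP b', of "p - 1 - i"]
      by (auto simp: rev_nth p_def Suc_diff_Suc)
  qed
  define X where "X = {i. i < p \<and> (\<exists>a\<in>A. E a (P ! i))}"
  define Y where "Y = {i. i < p \<and> (\<exists>b\<in>B. E b (P ! i))}"
  have XQ: "Q ! i \<notin> L" if "i \<in> X" for i
    using that A(3)[of _ i] PQ[of "i - 1"] Q0 by (cases i) (auto simp: X_def)
  have YQ: "Q ! (i + 2) \<notin> L" if "i \<in> Y" for i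
  proof (cases "Suc i < p")
    case True
    then show ?thesis
      using that B(3)[of _ i] PQ[of "Suc i"] by (auto simp: Y_def)
  next
    case False
    then have "i + 2 = Suc p"
      using that by (auto simp: Y_def)
    then show ?thesis
      using Q0 by simp
  qed
  have XY: "i + 2 \<notin> X" if iY: "i \<in> Y" for i
  proof
    assume "i + 2 \<in> X"
    then obtain a b where ab: "i + 2 < p" "a \<in> A" "E a (P ! (i + 2))" "b \<in> B" "E b (P ! i)"
      using iY by (auto simp: X_def Y_def)
    have 1: "path_in V E (take (i + 1) P)" "path_in V E (drop (i + 2) P)"
      using path_in_take_drop[OF P] ab by (auto simp: p_def)
    have 2: "set (take (i + 1) P) \<inter> set (drop (i + 2) P) = {}"
      using distP by (simp add: set_take_disj_set_drop_if_distinct)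
    have 3: "a \<noteq> b" "a \<notin> set P" "b \<notin> set P" "a \<in> V" "b \<in> V" "E (hd P) a" "E (last P) b"
      using ab disj in_V' by (auto simp: A_def B_def)
    have "path_in V E (take (i + 1) P @ b # rev (drop (i + 2) P))"
    proof (rule path_insert)
      show "path_in V E (take (i + 1) P)" "path_in V E (rev (drop (i + 2) P))"
        "set (take (i + 1) P) \<inter> set (rev (drop (i + 2) P)) = {}"
        using 1 2 by simp_all
      show "b \<notin> set (take (i + 1) P)" "b \<notin> set (rev (drop (i + 2) P))"
        using 3 by (auto dest: in_set_takeD in_set_dropD)
      show "E b (last (take (i + 1) P))" "E b (hd (rev (drop (i + 2) P)))"
        using ab 3 sym[OF 3(7)] by (simp_all add: last_take_nth hd_rev p_def)
    qed
    moreover have "hd (take (i + 1) P @ b # rev (drop (i + 2) P)) = hd P"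
      using ne by (cases P) auto
    moreover have "last (take (i + 1) P @ b # rev (drop (i + 2) P)) = P ! (i + 2)"
      using ab by (simp add: last_rev hd_drop_conv_nth p_def)
    ultimately have "cycle_in V E (a # take (i + 1) P @ b # rev (drop (i + 2) P))"
      using 3 ab(3) sym[OF 3(6)] by (intro cycle_Cons) (auto dest: in_set_takeD in_set_dropD)
    then have "length (a # take (i + 1) P @ b # rev (drop (i + 2) P)) + 1 \<noteq> r"
      by (rule no_cycle_missing_one)
    then show False
      using ab lenP by (simp add: p_def)
  qed
  \<comment> \<open>Positions on Q = x0, P, x1 are shifted by one against those on P, so the vertex on Q before
     the i-th vertex of P has index i, and the one after it has index i + 2.\<close>
  define Z where "Z = X \<union> (\<lambda>i. i + 2) ` (Y - X)"
  have finXY: "finite X" "finite Y"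
    by (auto simp: X_def Y_def)
  have "card Z = card X + card ((\<lambda>i. i + 2) ` (Y - X))"
    unfolding Z_def using XY finXY by (intro card_Un_disjoint) auto
  also have "card ((\<lambda>i. i + 2) ` (Y - X)) = card (Y - X)"
    by (rule card_image) (auto simp: inj_on_def)
  also have "card X + card (Y - X) = card (X \<union> Y)"
    using finXY card_Un_disjoint[of X "Y - X"] by auto
  finally have cardZ: "card Z = card (X \<union> Y)" .
  have ZL: "Q ! i \<notin> L" if "i \<in> Z" for i
    using that XQ YQ by (auto simp: Z_def)
  have Zr: "Z \<subseteq> {0..<0 + r}"
    using lenP by (auto simp: Z_def X_def Y_def)
  have "2 * card Z \<le> r + 1"
  proof (rule card_no_two_consecutive[OF Zr])
    fix i assume i: "i \<in> Z"
    show "Suc i \<notin> Z"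
    proof
      assume i': "Suc i \<in> Z"
      then have "Suc i < r"
        using Zr by auto
      then show False
        using Q_edge[of i] indep[of "Q ! i" "Q ! Suc i"] ZL[OF i] ZL[OF i'] by blast
    qed
  qed
  moreover have "{w. \<exists>u\<in>A \<union> B. E u w} \<subseteq> (!) P ` (X \<union> Y)"
  proof
    fix w assume "w \<in> {w. \<exists>u\<in>A \<union> B. E u w}"
    then obtain u where u: "u \<in> A \<union> B" "E u w"
      by blast
    then have "w \<in> set P"
      using A(2) B(2) by blast
    then obtain i where "i < p" "P ! i = w"
      by (auto simp: in_set_conv_nth p_def)
    then show "w \<in> (!) P ` (X \<union> Y)"
      using u by (auto simp: X_def Y_def)
  qed
  then have "card {w. \<exists>u\<in>A \<union> B. E u w} \<le> card (X \<union> Y)"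
    using finXY by (meson card_image_le card_mono finite_UnI finite_imageI le_trans)
  moreover have "card (A \<union> B) < 2 * card {w. \<exists>u\<in>A \<union> B. E u w}"
  proof (rule expansion)
    show "A \<union> B \<subseteq> V - L"
      using A(1) B(1) in_V' by (auto simp: A_def B_def)
    show "A \<union> B \<noteq> {}"
      using AB by auto
  qed
  moreover have "card (A \<union> B) = card A + card B"
    using fin disj by (rule card_Un_disjoint)
  ultimately show False
    using AB cardZ by linarith
qed

end

section \<open>Paths with k edges\<close>

context reduced_graph
begin

lemma longest_path:
  obtains xs where "path_in V E xs" "\<And>ys. path_in V E ys \<Longrightarrow> length ys \<le> length xs"
proof -
  obtain v where "path_in V E [v]"
    using V_nonempty by auto
  moreover have "\<forall>ys. path_in V E ys \<longrightarrow> length ys < Suc (card V)"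
    using path_length by (simp add: less_Suc_eq_le)
  ultimately show ?thesis
    using ex_has_greatest_nat[of "path_in V E" "[v]" length "Suc (card V)"] that by blast
qed

text \<open>
  A longest path with at most \<open>k\<close> vertices has low ends, since a high end could be extended.
\<close>

theorem long_path:
  obtains xs where "path_in V E xs" "length xs = k + 1"
proof -
  obtain xs where xs: "path_in V E xs" "\<And>ys. path_in V E ys \<Longrightarrow> length ys \<le> length xs"
    using longest_path by blast
  have "k + 1 \<le> length xs"
  proof (rule ccontr)
    assume short: "\<not> k + 1 \<le> length xs"
    have "hd ys \<notin> L" if ys: "path_in V E ys" "length ys = length xs" for ys
    proof
      assume "hd ys \<in> L"
      then have "length ys \<le> degree_in E (hd ys)"
        using L_degree[of "hd ys"] ys(2) short by linarith
      then obtain y where "path_in V E (y # ys)"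
        using extend_hd[OF ys(1)] by blast
      then show False
        using xs(2)[of "y # ys"] ys(2) by simp
    qed
    then interpret short_extremal_graph V E k "length xs"
      using xs short by unfold_locales auto
    show False
      by (rule no_short_extremal)
  qed
  then show ?thesis
    using that[of "take (k + 1) xs"] path_in_sublist[OF xs(1), of "k + 1" 0] by simp
qed

end

section \<open>Alternation along long paths\<close>

definition spaced_path :: "'a set \<Rightarrow> ('a \<Rightarrow> 'a \<Rightarrow> bool) \<Rightarrow> nat \<Rightarrow> nat \<Rightarrow> nat \<Rightarrow> nat \<Rightarrow> bool" where
  "spaced_path V E k a c e \<longleftrightarrow>
     (\<exists>xs. path_in V E xs \<and> length xs = a + c + e + 1 \<and>
           xs ! a \<in> high V E k \<and> xs ! (a + c) \<in> high V E k)"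

lemma (in simple_graph) spaced_path_rev:
  assumes "spaced_path V E k a c e"
  shows "spaced_path V E k e c a"
proof -
  obtain xs where xs: "path_in V E xs" "length xs = a + c + e + 1"
      "xs ! a \<in> high V E k" "xs ! (a + c) \<in> high V E k"
    using assms by (auto simp: spaced_path_def)
  then have "rev xs ! e = xs ! (a + c)" "rev xs ! (e + c) = xs ! a"
    by (simp_all add: rev_nth)
  then show ?thesis
    unfolding spaced_path_def using xs by (intro exI[of _ "rev xs"]) simp
qed

lemma (in simple_graph) spaced_path_mono:
  assumes "spaced_path W F k a c e" "W \<subseteq> V" "\<And>x y. F x y \<Longrightarrow> E x y"
  shows "spaced_path V E k a c e"
proof -
  have deg: "degree_in F v \<le> degree_in E v" for v
    using assms(3) by (rule degree_in_mono)
  have high: "v \<in> high V E k" if "v \<in> high W F k" for v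
    using that assms(2) le_trans[OF _ deg[of v], of k] by (auto simp: high_def)
  obtain xs where xs: "path_in W F xs" "length xs = a + c + e + 1"
      "xs ! a \<in> high W F k" "xs ! (a + c) \<in> high W F k"
    using assms(1) unfolding spaced_path_def by blast
  have "path_in V E xs"
    using xs(1) assms(2,3) by (rule path_in_mono)
  then show ?thesis
    unfolding spaced_path_def using xs(2) high[OF xs(3)] high[OF xs(4)] by (intro exI[of _ xs]) simp
qed

locale no_spaced_path = reduced_graph +
  fixes a c e l :: nat
  assumes no_spaced: "\<not> spaced_path V E k a c e"
    and k_eq: "k = a + c + e + l"
    and c_pos: "1 \<le> c"
    and c_le: "c \<le> l"
begin

lemma not_both:
  assumes P: "path_in V E xs" and i: "a \<le> i" "i + c + e < length xs"
  shows "xs ! i \<notin> L \<or> xs ! (i + c) \<notin> L"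
proof -
  let ?ys = "take (a + c + e + 1) (drop (i - a) xs)"
  have "path_in V E ?ys"
    using i by (intro path_in_sublist[OF P]) auto
  moreover have "length ?ys = a + c + e + 1" "?ys ! a = xs ! i" "?ys ! (a + c) = xs ! (i + c)"
    using i by (auto simp: nth_drop intro!: arg_cong[of _ _ "(!) xs"])
  ultimately show ?thesis
    using no_spaced unfolding spaced_path_def by metis
qed

text \<open>
  Suppose that the vertices at \<open>i\<close> and \<open>i + 1\<close> are both high. Then the vertices at \<open>i + c\<close> and \<open>i + 1 + c\<close>
  would be two adjacent low vertices, unless these positions are too close to the end of the path. In that
  case, as \<open>c \<le> l\<close> and the path has at least \<open>k = a + c + e + l\<close> edges, the same argument applies to
  \<open>i - c\<close> and \<open>i + 1 - c\<close>.
\<close>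

lemma alternates:
  assumes P: "path_in V E xs" and len: "k < length xs" and i: "a \<le> i" "Suc i + e < length xs"
  shows "xs ! i \<notin> L \<or> xs ! Suc i \<notin> L"
proof (rule ccontr)
  assume "\<not> ?thesis"
  then have h: "xs ! i \<in> L" "xs ! Suc i \<in> L"
    by auto
  show False
  proof (cases "Suc i + c + e < length xs")
    case True
    then have "xs ! (i + c) \<notin> L" "xs ! Suc (i + c) \<notin> L"
      using not_both[OF P, of i] not_both[OF P, of "Suc i"] h i by auto
    moreover have "E (xs ! (i + c)) (xs ! Suc (i + c))"
      using path_in_nth[OF P, of "i + c"] True by simp
    ultimately show False
      using indep by blast
  next
    case False
    then obtain j where j: "i = j + c" "a \<le> j"
      using len k_eq c_le that[of "i - c"] by fastforce
    then have "xs ! j \<notin> L" "xs ! Suc j \<notin> L"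
      using not_both[OF P, of j] not_both[OF P, of "Suc j"] h i by auto
    moreover have "E (xs ! j) (xs ! Suc j)"
      using path_in_nth[OF P, of j] j i by simp
    ultimately show False
      using indep by blast
  qed
qed

lemma c_odd: "odd c"
proof
  assume "even c"
  then obtain d where d: "c = 2 * d"
    by (elim evenE)
  obtain xs where xs: "path_in V E xs" "length xs = k + 1"
    using long_path .
  have step: "xs ! Suc i \<in> L \<longleftrightarrow> xs ! i \<notin> L" if "a \<le> i" "Suc i + e \<le> k" for i
    using alternates[OF xs(1), of i] path_in_nth[OF xs(1), of i] indep[of "xs ! i" "xs ! Suc i"] that xs(2)
    by auto
  have even: "xs ! (i + 2 * t) \<in> L \<longleftrightarrow> xs ! i \<in> L" if "a \<le> i" "i + 2 * t + e \<le> k" for i t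
    using that
  proof (induction t)
    case (Suc t)
    then show ?case
      using step[of "i + 2 * t"] step[of "Suc (i + 2 * t)"] by simp
  qed simp
  have "xs ! i \<notin> L" if "a \<le> i" "i \<le> Suc a" for i
    using even[of i d] not_both[OF xs(1), of i] that xs(2) k_eq c_le c_pos d by auto
  then show False
    using step[of a] k_eq c_pos by auto
qed

end

section \<open>Graphs with few vertices\<close>

locale no_spaced_path_dense = no_spaced_path +
  assumes a_le: "a \<le> e" and dense: "card V div 2 \<le> l + c"
begin

lemma card_low_le: "card (V - L) \<le> k - 2 * a" "2 * a \<le> k"
  using card_low dense k_eq a_le by linarith+

text \<open>
  The alternating parts of the path and of its reverse overlap, because \<open>2e \<le> k\<close>. So only the
  first and the last \<open>a\<close> vertices are exceptional.
\<close>

lemma alternates_sym: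
  assumes P: "path_in V E xs" and len: "k < length xs" and i: "a \<le> i" "Suc i + a < length xs"
  shows "xs ! i \<notin> L \<or> xs ! Suc i \<notin> L"
proof (cases "Suc i + e < length xs")
  case True
  then show ?thesis
    using alternates[OF P len i(1)] by blast
next
  case False
  define j where "j = length xs - 2 - i"
  have "e \<le> i"
    using False len card_V_gt dense k_eq by linarith
  then have "Suc j + e < length (rev xs)" "a \<le> j"
    using i by (auto simp: j_def)
  then have "rev xs ! j \<notin> L \<or> rev xs ! Suc j \<notin> L"
    using alternates[of "rev xs" j] P len by simp
  moreover have "rev xs ! j = xs ! Suc i" "rev xs ! Suc j = xs ! i"
    using i by (auto simp: j_def rev_nth intro!: arg_cong[of _ _ "(!) xs"])
  ultimately show ?thesis
    by metis
qed

text \<open>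
  All neighbours of a high first vertex lie on the longest path. By a rotation and alternation,
  those that are not among the exceptional \<open>2a\<close> vertices are low. So there are at least
  \<open>k - 2a\<close> low vertices, which is the largest possible number of low vertices in the graph. They all lie
  on the path, no two of them consecutive, and this leaves room for no exceptional
  vertices: \<open>a = 0\<close>.
\<close>

lemma high_ended_longest:
  assumes P: "path_in V E xs" and len: "k < length xs"
    and longest: "\<And>ys. path_in V E ys \<Longrightarrow> length ys \<le> length xs" and hd: "hd xs \<in> L"
  shows "card (V - L) = k" "{w. E (hd xs) w} = V - L"
proof -
  let ?r = "length xs"
  have ne: "xs \<noteq> []"
    using len by auto
  have dist: "distinct xs" and sub: "set xs \<subseteq> V"
    using P by (auto simp: path_in_def)
  define NS where "NS = {j. a + 1 \<le> j \<and> j + a < ?r \<and> E (hd xs) (xs ! j)}"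
  have finNS: "finite NS"
    by (rule finite_subset[of _ "{..<?r}"]) (auto simp: NS_def)
  have NSL: "xs ! j \<notin> L" if "j \<in> NS" for j
  proof -
    have j: "0 < j" "j < ?r" "E (hd xs) (xs ! j)" "a \<le> j - 1" "j + a < ?r"
      using that by (auto simp: NS_def)
    note rot = posa_rotation[OF P j(1-3)]
    let ?zs = "rev (take j xs) @ drop j xs"
    have "?zs ! (j - 1) \<notin> L \<or> ?zs ! Suc (j - 1) \<notin> L"
      using j len by (intro alternates_sym[OF rot(1)]) auto
    then show ?thesis
      using rot(4,5) hd j by simp
  qed
  \<comment> \<open>NS consists of the positions of neighbours that the alternation can reach.\<close>
  have nb: "{w. E (hd xs) w} \<subseteq> (!) xs ` (NS \<union> {1..a} \<union> {?r - a..<?r})"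
  proof
    fix w assume "w \<in> {w. E (hd xs) w}"
    then have w: "E (hd xs) w"
      by simp
    have "w \<in> set xs"
    proof (rule ccontr)
      assume "w \<notin> set xs"
      then have "path_in V E (w # xs)"
        using P ne sym[OF w] in_V'[OF w] by (simp add: path_in_Cons)
      then show False
        using longest[of "w # xs"] by simp
    qed
    then obtain j where j: "j < ?r" "xs ! j = w"
      by (auto simp: in_set_conv_nth)
    have "j \<noteq> 0"
      using j w irrefl[of w] hd_conv_nth[OF ne] by (cases j) auto
    then have "j \<in> NS \<union> {1..a} \<union> {?r - a..<?r}"
      using j w by (auto simp: NS_def)
    then show "w \<in> (!) xs ` (NS \<union> {1..a} \<union> {?r - a..<?r})"
      using j by blast
  qed
  have "k \<le> card {w. E (hd xs) w}"
    using L_degree[OF hd] by (simp add: degree_in_def)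
  also have "\<dots> \<le> card ((!) xs ` (NS \<union> {1..a} \<union> {?r - a..<?r}))"
    using nb finNS by (intro card_mono) auto
  also have "\<dots> \<le> card (NS \<union> {1..a} \<union> {?r - a..<?r})"
    using finNS by (intro card_image_le) auto
  also have "\<dots> \<le> card NS + card {1..a} + card {?r - a..<?r}"
    by (meson add_le_mono card_Un_le le_refl le_trans)
  finally have kNS: "k \<le> card NS + 2 * a"
    by simp
  have NS_sub: "(!) xs ` NS \<subseteq> V - L"
    using NSL sub by (force simp: NS_def)
  have "card NS = card ((!) xs ` NS)"
    using dist by (intro card_nth_image[symmetric]) (auto simp: NS_def)
  also have "\<dots> \<le> card (V - L)"
    using NS_sub finite_V by (intro card_mono) auto
  finally have NS_le: "card NS \<le> card (V - L)" .
  have "2 * card NS \<le> (?r - 2 * a - 1) + 1"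
  proof (rule card_no_two_consecutive)
    show "NS \<subseteq> {a + 1..<a + 1 + (?r - 2 * a - 1)}"
      by (auto simp: NS_def)
    show "Suc j \<notin> NS" if j: "j \<in> NS" for j
    proof
      assume j': "Suc j \<in> NS"
      then have "E (xs ! j) (xs ! Suc j)"
        using path_in_nth[OF P, of j] by (simp add: NS_def)
      then show False
        using indep NSL[OF j] NSL[OF j'] by blast
    qed
  qed
  moreover have "2 * a < ?r"
    using card_low_le(2) len by linarith
  ultimately have "2 * card NS + 2 * a \<le> ?r"
    by linarith
  moreover have "?r \<le> 2 * (card V div 2) + 1"
    using path_length[OF P] by linarith
  ultimately have a0: "a = 0"
    using kNS dense k_eq a_le by linarith
  show card: "card (V - L) = k"
    using kNS NS_le card_low_le a0 by simp
  have "{w. E (hd xs) w} \<subseteq> V - L"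
    using nb NS_sub a0 by auto
  then show "{w. E (hd xs) w} = V - L"
    using finite_V L_degree[OF hd] card unfolding degree_in_def by (intro card_seteq) auto
qed

text \<open>
  If a longest path had a high first vertex, this vertex would be adjacent to all low vertices.
  Rotations make the predecessor of any low vertex the first vertex of a longest path; these
  \<open>k\<close> predecessors are then adjacent to all low vertices, too, and a low vertex would have degree
  \<open>k\<close>.
\<close>

lemma longest_path_ends:
  assumes P: "path_in V E xs" and len: "k < length xs"
    and longest: "\<And>ys. path_in V E ys \<Longrightarrow> length ys \<le> length xs"
  shows "hd xs \<notin> L"
proof
  assume hd: "hd xs \<in> L"
  have low: "card (V - L) = k" "{w. E (hd xs) w} = V - L"
    using high_ended_longest[OF P len _ hd] longest by blast+
  have dist: "distinct xs"
    using P by (auto simp: path_in_def)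
  have ne: "xs \<noteq> []"
    using len by auto
  have "0 < k"
    using k_eq c_pos by simp
  then have "V - L \<noteq> {}"
    using low(1) by fastforce
  then obtain s where s: "s \<in> V" "s \<notin> L"
    by blast
  define J where "J = {j. 0 < j \<and> j < length xs \<and> xs ! j \<in> V - L}"
  have finJ: "finite J"
    by (auto simp: J_def)
  have "V - L \<subseteq> (!) xs ` J"
  proof
    fix t assume t: "t \<in> V - L"
    then have ht: "E (hd xs) t"
      using low(2) by blast
    have "t \<in> set xs"
    proof (rule ccontr)
      assume "t \<notin> set xs"
      then have "path_in V E (t # xs)"
        using P ne sym[OF ht] t by (simp add: path_in_Cons)
      then show False
        using longest[of "t # xs"] by simp
    qed
    then obtain j where j: "j < length xs" "xs ! j = t"
      by (auto simp: in_set_conv_nth)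
    have "j \<noteq> 0"
      using j t hd hd_conv_nth[OF ne] by (cases j) auto
    then show "t \<in> (!) xs ` J"
      using j t by (auto simp: J_def)
  qed
  then have "card (V - L) \<le> card ((!) xs ` J)"
    using finJ by (intro card_mono) auto
  also have "\<dots> \<le> card J"
    using finJ by (rule card_image_le)
  also have "card J = card ((\<lambda>j. xs ! (j - 1)) ` J)"
    using dist by (intro card_image[symmetric] inj_onI) (auto simp: J_def nth_eq_iff_index_eq)
  also have "\<dots> \<le> card {w. E s w}"
  proof (rule card_mono)
    show "(\<lambda>j. xs ! (j - 1)) ` J \<subseteq> {w. E s w}"
    proof safe
      fix j assume "j \<in> J"
      then have j: "0 < j" "j < length xs" "xs ! j \<in> V - L"
        by (auto simp: J_def)
      have "E (hd xs) (xs ! j)"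
        using j(3) low(2) by blast
      note rot = posa_rotation[OF P j(1,2) this]
      let ?zs = "rev (take j xs) @ drop j xs"
      have "E (xs ! (j - 1)) (xs ! j)"
        using path_in_nth[OF P, of "j - 1"] j by simp
      then have "hd ?zs \<in> L"
        using rot(2) indep j(3) by force
      moreover have "length ?zs = length xs"
        using j by simp
      ultimately have "{w. E (hd ?zs) w} = V - L"
        using high_ended_longest(2)[OF rot(1)] len longest by simp
      then have "E (xs ! (j - 1)) s"
        using s rot(2) by (metis DiffI mem_Collect_eq)
      then show "E s (xs ! (j - 1))"
        by (rule sym)
    qed
  qed simp
  finally have "s \<in> L"
    using s(1) low(1) by (simp add: high_def degree_in_def)
  then show False
    using s(2) by blast
qed

text \<open>
  It remains to exclude that a longest path has more than \<open>k + 1\<close> vertices. Without its low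
  first vertex it still has at least \<open>k\<close> edges, so that the alternation applies to it and to its rotations.
  Counting the neighbours of its high first vertex shows that this vertex is adjacent to all low vertices, in
  particular to the last one. The resulting cycle contains all high vertices and must have two
  consecutive ones, against alternation.
\<close>

theorem no_dense_counterexample: False
proof -
  obtain xs where xs: "path_in V E xs" and longest: "\<And>ys. path_in V E ys \<Longrightarrow> length ys \<le> length xs"
    using longest_path by blast
  define r where "r = length xs"
  obtain us where "path_in V E us" "length us = k + 1"
    using long_path .
  then have kr: "k < r"
    using longest[of us] by (simp add: r_def)
  have ends: "hd ys \<notin> L" if "path_in V E ys" "length ys = r" for ys
    using longest_path_ends[OF that(1)] that(2) kr longest by (simp add: r_def)
  interpret extremal_graph V E k r
    using xs longest ends by unfold_locales (auto simp: r_def)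
  have "k + 1 < r"
  proof (rule ccontr)
    assume "\<not> k + 1 < r"
    then interpret short_extremal_graph V E k r
      by unfold_locales simp
    show False
      by (rule no_short_extremal)
  qed
  obtain x P where xP: "xs = x # P" "P \<noteq> []"
    using kr r_def \<open>k + 1 < r\<close> by (cases xs; cases "tl xs") auto
  have P: "path_in V E P" "E x (hd P)" "x \<notin> set P"
    using xs xP by (auto simp: path_in_Cons)
  have lenP: "length P + 1 = r" "k < length P"
    using xP \<open>k + 1 < r\<close> by (auto simp: r_def)
  have distP: "distinct P"
    using P by (auto simp: path_in_def)
  have x: "x \<notin> L" and lastL: "last P \<notin> L"
    using ends[of xs] path_ends'[of xs] xs xP by (auto simp: r_def)
  have hdL: "hd P \<in> L"
    using indep'[OF P(2) x] .
  let ?p = "length P"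
  \<comment> \<open>The last vertex of P is low. So only 2a - 1 of the 2a exceptional positions can carry a high
     neighbour, and this strictness forces a = 0.\<close>
  have nb: "{w. E (hd P) w} \<inter> L \<subseteq> (!) P ` ({1..a} \<union> {?p - a..<?p - 1})"
  proof
    fix w assume "w \<in> {w. E (hd P) w} \<inter> L"
    then have w: "E (hd P) w" "w \<in> L"
      by auto
    have "w \<in> set P"
    proof (rule ccontr)
      assume "w \<notin> set P"
      then have "path_in V E (w # P)"
        using P(1) xP(2) sym[OF w(1)] in_V'[OF w(1)] by (simp add: path_in_Cons)
      then show False
        using ends[of "w # P"] lenP w by simp
    qed
    then obtain j where j: "j < ?p" "P ! j = w"
      by (auto simp: in_set_conv_nth)
    have j0: "0 < j"
      using j w irrefl[of w] hd_conv_nth[OF xP(2)] by (cases j) auto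
    have jl: "j \<noteq> ?p - 1"
      using j w lastL last_conv_nth[OF xP(2)] by auto
    have "\<not> (a < j \<and> j + a < ?p)"
    proof
      assume aj: "a < j \<and> j + a < ?p"
      have "E (hd P) (P ! j)"
        using w j by simp
      note rot = posa_rotation[OF P(1) j0 j(1) this]
      let ?zs = "rev (take j P) @ drop j P"
      have "?zs ! (j - 1) \<notin> L \<or> ?zs ! Suc (j - 1) \<notin> L"
        using j0 j aj lenP by (intro alternates_sym[OF rot(1)]) auto
      then show False
        using rot(4,5) hdL j0 j w by simp
    qed
    then have "j \<in> {1..a} \<union> {?p - a..<?p - 1}"
      using j0 jl j by auto
    then show "w \<in> (!) P ` ({1..a} \<union> {?p - a..<?p - 1})"
      using j by blast
  qed
  have "card ({w. E (hd P) w} \<inter> L) \<le> card ((!) P ` ({1..a} \<union> {?p - a..<?p - 1}))"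
    using nb by (intro card_mono) auto
  also have "\<dots> \<le> card ({1..a} \<union> {?p - a..<?p - 1})"
    by (intro card_image_le) auto
  also have "\<dots> \<le> card {1..a} + card {?p - a..<?p - 1}"
    by (rule card_Un_le)
  finally have NL: "card ({w. E (hd P) w} \<inter> L) \<le> a + (?p - 1 - (?p - a))"
    by simp
  have sub: "{w. E (hd P) w} - L \<subseteq> V - L"
    using in_V' by blast
  have deg: "k \<le> card ({w. E (hd P) w} - L) + card ({w. E (hd P) w} \<inter> L)"
    using L_degree[OF hdL] degree_split[of "hd P" L] by simp
  have NS: "card ({w. E (hd P) w} - L) \<le> card (V - L)"
    using sub finite_V by (intro card_mono) auto
  have a0: "a = 0"
    using deg NS NL card_low_le lenP k_eq c_pos by linarith
  have "{w. E (hd P) w} - L = V - L"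
    using sub finite_V deg NL a0 card_low_le by (intro card_seteq) auto
  moreover have "last P \<in> V"
    using P(1) xP(2) by (auto simp: path_in_def)
  ultimately have "E (hd P) (last P)"
    using lastL by blast
  then have C: "cycle_in V E P"
    using P(1) sym by (simp add: cycle_in_def)
  have "card V \<le> ?p + card {i. i < ?p \<and> P ! i \<in> L \<and> P ! (Suc i mod ?p) \<in> L}"
    using cycle_count[OF C cycle_missing_one_covers_high[OF C lenP(1)]] .
  moreover have "r \<le> card V"
    using path_length[OF xs] by (simp add: r_def)
  ultimately have "card {i. i < ?p \<and> P ! i \<in> L \<and> P ! (Suc i mod ?p) \<in> L} \<noteq> 0"
    using lenP by linarith
  then obtain i where i: "i < ?p" "P ! i \<in> L" "P ! (Suc i mod ?p) \<in> L"
    by (metis (mono_tags, lifting) card.empty ex_in_conv mem_Collect_eq)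
  show False
  proof (cases "Suc i < ?p")
    case True
    then show False
      using alternates_sym[OF P(1) lenP(2), of i] i a0 by simp
  next
    case False
    then have "P ! i = last P"
      using i last_conv_nth[OF xP(2)] by (metis Suc_lessI diff_Suc_1)
    then show False
      using i lastL by simp
  qed
qed

end

section \<open>Reduction to reduced graphs\<close>

lemma (in reduced_graph) spaced_path_if_reduced:
  assumes k: "k = a + c + e + l" "1 \<le> c" "c \<le> l"
    and "even c \<or> card V div 2 \<le> l + c"
  shows "spaced_path V E k a c e"
proof (rule ccontr)
  assume no: "\<not> spaced_path V E k a c e"
  interpret no_spaced_path V E k a c e l
    using no k by unfold_locales
  have dense: "card V div 2 \<le> l + c"
    using assms(4) c_odd by blast
  show False
  proof (cases "a \<le> e")
    case True
    then interpret no_spaced_path_dense V E k a c e l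
      using dense by unfold_locales
    show False
      by (rule no_dense_counterexample)
  next
    case False
    then interpret rev: no_spaced_path_dense V E k e c a l
      using dense no spaced_path_rev k by unfold_locales auto
    show False
      by (rule rev.no_dense_counterexample)
  qed
qed

text \<open>
  Induction on the number of vertices. In a smallest counterexample, with edges between low vertices
  removed, no smaller induced subgraph can have at least half of its vertices high. Applied to a union
  of components and its complement, this gives connectedness; applied to the complement of a set of
  low vertices, where high vertices can only lose their status by being adjacent to this set, it
  gives expansion.
\<close>

theorem spaced_path_exists:
  fixes V :: "'a set"
  assumes "simple_graph V E" "V \<noteq> {}" "card V \<le> 2 * card (high V E k)"
    and k: "k = a + c + e + l" "1 \<le> c" "c \<le> l"
    and "even c \<or> card V div 2 \<le> l + c"
  shows "spaced_path V E k a c e"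
  using assms(1-3,7)
proof (induction "card V" arbitrary: V E rule: less_induct)
  case less
  interpret G: simple_graph V E
    by fact
  define H where "H = high V E k"
  define F where "F x y \<longleftrightarrow> E x y \<and> (x \<in> H \<or> y \<in> H)" for x y
  have F_sub: "F x y \<Longrightarrow> E x y" for x y
    by (simp add: F_def)
  have F_sym: "F x y \<Longrightarrow> F y x" for x y
    using G.sym by (auto simp: F_def)
  have sgF: "simple_graph V F"
    using G.finite_V G.sym G.irrefl G.in_V by unfold_locales (auto simp: F_def)
  interpret F: simple_graph V F
    by fact
  have H_sub: "H \<subseteq> V"
    by (auto simp: H_def high_def)
  have finH: "finite H"
    using H_sub G.finite_V finite_subset by blast
  have H_ne: "H \<noteq> {}"
    using less.prems(2,3) G.finite_V by (auto simp: H_def)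
  have F_nbrs: "{y. F x y} = {y. E x y}" if "x \<in> H" for x
    using that by (auto simp: F_def)
  have highF: "high V F k = H"
  proof
    have deg: "degree_in F v \<le> degree_in E v" for v
      using F_sub by (rule G.degree_in_mono)
    show "high V F k \<subseteq> H"
      using le_trans[OF _ deg, of k] unfolding H_def high_def by blast
    show "H \<subseteq> high V F k"
      using F_nbrs by (auto simp: high_def degree_in_def H_def)
  qed
  show ?case
  proof (rule ccontr)
    assume no: "\<not> spaced_path V E k a c e"
    \<comment> \<open>The vertices in M keep all their neighbours in the subgraph induced on W, hence stay high.\<close>
    have few: "2 * card M < card W" if W: "W \<subset> V" "W \<noteq> {}" "M \<subseteq> W \<inter> H"
      and M: "\<And>x y. x \<in> M \<Longrightarrow> F x y \<Longrightarrow> y \<in> W" for W M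
    proof (rule ccontr)
      assume many: "\<not> 2 * card M < card W"
      define E' where "E' x y \<longleftrightarrow> F x y \<and> x \<in> W \<and> y \<in> W" for x y
      have sg: "simple_graph W E'"
        using W finite_subset[of W V] G.finite_V F_sym F.irrefl
        by unfold_locales (auto simp: E'_def)
      have "{y. E' x y} = {y. E x y}" if "x \<in> M" for x
      proof -
        have "{y. E' x y} = {y. F x y}"
          using that M[OF that] W(3) by (auto simp: E'_def)
        also have "\<dots> = {y. E x y}"
          using F_nbrs that W(3) by blast
        finally show ?thesis .
      qed
      then have "M \<subseteq> high W E' k"
        using W by (auto simp: high_def degree_in_def H_def)
      then have "card M \<le> card (high W E' k)"
        using sg by (intro card_mono) (auto simp: high_def simple_graph_def)
      then have "card W \<le> 2 * card (high W E' k)"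
        using many by linarith
      moreover have lt: "card W < card V"
        using W G.finite_V by (intro psubset_card_mono)
      moreover have "even c \<or> card W div 2 \<le> l + c"
        using less.prems(4) lt div_le_mono[of "card W" "card V" 2] by linarith
      ultimately have "spaced_path W E' k a c e"
        using less.hyps[OF lt sg W(2)] by blast
      then show False
        using no G.spaced_path_mono[of W E' k a c e] W F_sub by (auto simp: E'_def)
    qed
    have "reduced_graph V F k"
    proof (unfold_locales, unfold highF)
      show "V \<noteq> {}"
        by fact
      show "card V \<le> 2 * card H"
        using less.prems(3) by (simp add: H_def)
      show "x \<in> H \<or> y \<in> H" if "F x y" for x y
        using that by (simp add: F_def)
    next
      fix K assume K: "K \<subseteq> V" "K \<noteq> {}" "\<And>x y. x \<in> K \<Longrightarrow> F x y \<Longrightarrow> y \<in> K"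
      show "K = V"
      proof (rule ccontr)
        assume "K \<noteq> V"
        then have "2 * card (H \<inter> K) < card K"
          using K by (intro few) auto
        moreover have "2 * card (H - K) < card (V - K)"
        proof (rule few)
          show "V - K \<subset> V" "V - K \<noteq> {}" "H - K \<subseteq> (V - K) \<inter> H"
            using K \<open>K \<noteq> V\<close> H_sub by auto
          show "y \<in> V - K" if "x \<in> H - K" "F x y" for x y
            using that K(3)[of y x] F_sym F.in_V' by blast
        qed
        moreover have "card (H \<inter> K) + card (H - K) = card H"
          using finH by (metis Int_Diff_Un Int_Diff_disjoint card_Un_disjoint finite_Diff finite_Int)
        moreover have "card (V - K) + card K = card V"
          using K(1) G.finite_V by (metis card_Diff_subset card_mono finite_subset le_add_diff_inverse2)
        ultimately show False
          using less.prems(3) by (simp add: H_def)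
      qed
    next
      fix U assume U: "U \<subseteq> V - H" "U \<noteq> {}"
      define T where "T = {w. \<exists>u\<in>U. F u w}"
      have "T \<subseteq> H"
        using U by (auto simp: T_def F_def)
      have "2 * card (H - T) < card (V - U)"
      proof (rule few)
        show "V - U \<subset> V" "V - U \<noteq> {}" "H - T \<subseteq> (V - U) \<inter> H"
          using U H_ne H_sub by auto
        show "y \<in> V - U" if "x \<in> H - T" "F x y" for x y
          using that F_sym F.in_V' by (auto simp: T_def)
      qed
      moreover have "card (H - T) = card H - card T"
        using \<open>T \<subseteq> H\<close> finH by (meson card_Diff_subset finite_subset)
      moreover have "card (V - U) + card U = card V"
        using U(1) G.finite_V by (metis Diff_subset card_Diff_subset card_mono finite_subset le_add_diff_inverse2 subset_trans)
      ultimately show "card U < 2 * card {w. \<exists>u\<in>U. F u w}"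
        using less.prems(3) unfolding T_def[symmetric] H_def by linarith
    qed
    then interpret R: reduced_graph V F k .
    have "spaced_path V F k a c e"
      using R.spaced_path_if_reduced[OF k less.prems(4)] .
    then show False
      using no G.spaced_path_mono[of V F] F_sub by blast
  qed
qed

section \<open>Embedding double brooms\<close>

lemma contains_subgraph_iso:
  assumes "digraph_iso (with_proj H) (with_proj T)" "contains_subgraph G H"
  shows "contains_subgraph G T"
proof -
  obtain h where h: "pre_digraph.digraph_isomorphism (with_proj H) h" "with_proj T = app_iso h (with_proj H)"
    using assms(1) by (auto simp: digraph_iso_def)
  obtain f where f: "inj_on f (pverts H)" "f ` pverts H \<subseteq> pverts G"
      "\<And>u v. (u, v) \<in> parcs H \<Longrightarrow> (f u, f v) \<in> parcs G"
    using assms(2) by (auto simp: contains_subgraph_def)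
  let ?g = "iso_verts h"
  have wf: "wf_digraph (with_proj H)" and inj: "inj_on ?g (pverts H)"
    and arc: "\<And>x. x \<in> parcs H \<Longrightarrow>
      ?g (fst x) = iso_tail h (iso_arcs h x) \<and> ?g (snd x) = iso_head h (iso_arcs h x)"
    using h(1) by (auto simp: pre_digraph.digraph_isomorphism_def)
  have T: "pverts T = ?g ` pverts H" "parcs T = iso_arcs h ` parcs H" "iso_tail h = fst" "iso_head h = snd"
    using arg_cong[OF h(2), of verts] arg_cong[OF h(2), of arcs]
      arg_cong[OF h(2), of tail] arg_cong[OF h(2), of head] by simp_all
  let ?i = "the_inv_into (pverts H) ?g"
  have inv: "?i (?g x) = x" if "x \<in> pverts H" for x
    using the_inv_into_f_f[OF inj that] .
  have "inj_on (f \<circ> ?i) (pverts T)"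
    using f(1) inv by (auto simp: T inj_on_def)
  moreover have "(f \<circ> ?i) ` pverts T \<subseteq> pverts G"
    using f(2) inv by (auto simp: T)
  moreover have "((f \<circ> ?i) u, (f \<circ> ?i) v) \<in> parcs G" if uv: "(u, v) \<in> parcs T" for u v
  proof -
    obtain x where x: "x \<in> parcs H" "(u, v) = iso_arcs h x"
      using uv T by auto
    have "u = ?g (fst x)" "v = ?g (snd x)"
      using arc[OF x(1)] by (simp_all add: T x(2)[symmetric])
    moreover have "fst x \<in> pverts H" "snd x \<in> pverts H"
      using wf_digraph.tail_in_verts[OF wf, of x] wf_digraph.head_in_verts[OF wf, of x] x by auto
    ultimately show ?thesis
      using f(3)[of "fst x" "snd x"] x inv by simp
  qed
  ultimately show ?thesis
    unfolding contains_subgraph_def by blast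
qed

text \<open>
  The path has \<open>k - b - d\<close> edges, so a high vertex on it has at least \<open>b + d\<close> neighbours outside.
  The \<open>b\<close> leaves at the first centre leave at least \<open>d\<close> of these for the second one.
\<close>

lemma double_broom_if_spaced_path:
  assumes "simple_graph (pverts G) (\<lambda>x y. (x, y) \<in> parcs G)"
    and "spaced_path (pverts G) (\<lambda>x y. (x, y) \<in> parcs G) k a c e"
    and k: "k = a + b + c + d + e"
  shows "contains_subgraph G (double_broom a b c d e)"
proof -
  let ?E = "\<lambda>x y. (x, y) \<in> parcs G"
  interpret simple_graph "pverts G" ?E
    by fact
  obtain xs where xs: "path_in (pverts G) ?E xs" "length xs = a + c + e + 1"
      "k \<le> degree_in ?E (xs ! a)" "k \<le> degree_in ?E (xs ! (a + c))"
    using assms(2) by (auto simp: spaced_path_def high_def)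
  have dist: "distinct xs" and sub: "set xs \<subseteq> pverts G"
    using xs(1) by (auto simp: path_in_def)
  have "b \<le> card ({w. ?E (xs ! a) w} - set xs)"
    using card_nbrs_outside[OF dist, of "xs ! a"] xs k by simp
  then obtain B where B: "B \<subseteq> {w. ?E (xs ! a) w} - set xs" "card B = b" "finite B"
    using obtain_subset_with_card_n by metis
  have "b + d \<le> card ({w. ?E (xs ! (a + c)) w} - set xs)"
    using card_nbrs_outside[OF dist, of "xs ! (a + c)"] xs k by simp
  then have "d \<le> card ({w. ?E (xs ! (a + c)) w} - set xs - B)"
    using diff_card_le_card_Diff[OF B(3), of "{w. ?E (xs ! (a + c)) w} - set xs"] B(2) by linarith
  then obtain D where D: "D \<subseteq> {w. ?E (xs ! (a + c)) w} - set xs - B" "card D = d" "finite D"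
    using obtain_subset_with_card_n by metis
  obtain bs where bs: "set bs = B" "distinct bs"
    using finite_distinct_list[OF B(3)] by blast
  obtain ds where ds: "set ds = D" "distinct ds"
    using finite_distinct_list[OF D(3)] by blast
  have lens: "length bs = b" "length ds = d"
    using B(2) D(2) bs ds distinct_card by metis+
  define f where "f v = (case v of Path i \<Rightarrow> xs ! i | Leaf1 j \<Rightarrow> bs ! j | Leaf2 j \<Rightarrow> ds ! j)" for v
  have f1: "xs ! i \<in> set xs" if "i \<le> a + c + e" for i
    using that xs(2) by simp
  have f2: "bs ! j \<in> B" if "j < b" for j
    using that bs lens nth_mem by metis
  have f3: "ds ! j \<in> D" if "j < d" for j
    using that ds lens nth_mem by metis
  have ne: "xs ! i \<noteq> bs ! j" if "i \<le> a + c + e" "j < b" for i j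
    using f1[OF that(1)] f2[OF that(2)] B(1) by auto
  have ne': "xs ! i \<noteq> ds ! j" if "i \<le> a + c + e" "j < d" for i j
    using f1[OF that(1)] f3[OF that(2)] D(1) by auto
  have ne'': "bs ! i \<noteq> ds ! j" if "i < b" "j < d" for i j
    using f2[OF that(1)] f3[OF that(2)] D(1) by auto
  have eq: "xs ! i = xs ! j \<longleftrightarrow> i = j" if "i \<le> a + c + e" "j \<le> a + c + e" for i j
    using dist xs(2) that by (simp add: nth_eq_iff_index_eq)
  have eq': "bs ! i = bs ! j \<longleftrightarrow> i = j" if "i < b" "j < b" for i j
    using bs(2) lens(1) that by (simp add: nth_eq_iff_index_eq)
  have eq'': "ds ! i = ds ! j \<longleftrightarrow> i = j" if "i < d" "j < d" for i j
    using ds(2) lens(2) that by (simp add: nth_eq_iff_index_eq)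
  have inj: "inj_on f (pverts (double_broom a b c d e))"
    by (auto simp: inj_on_def double_broom_def f_def eq eq' eq'' ne ne' ne''
        ne[symmetric] ne'[symmetric] ne''[symmetric])
  have edge: "?E (xs ! i) (xs ! Suc i)" if "i < a + c + e" for i
    using path_in_nth[OF xs(1)] xs(2) that by simp
  have edge': "?E (xs ! a) (bs ! j)" if "j < b" for j
    using f2[OF that] B(1) by blast
  have edge'': "?E (xs ! (a + c)) (ds ! j)" if "j < d" for j
    using f3[OF that] D(1) by blast
  have verts: "xs ! i \<in> pverts G" if "i \<le> a + c + e" for i
    using f1[OF that] sub by blast
  have img: "f ` pverts (double_broom a b c d e) \<subseteq> pverts G"
    using in_V'[OF edge'] in_V'[OF edge''] verts by (auto simp: double_broom_def f_def)
  have arcs: "(f u, f v) \<in> parcs G" if "(u, v) \<in> double_broom_edges a b c d e" for u v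
    using that edge edge' edge'' by (auto simp: double_broom_edges_def f_def)
  have "(f u, f v) \<in> parcs G" if "(u, v) \<in> parcs (double_broom a b c d e)" for u v
  proof -
    have "(u, v) \<in> double_broom_edges a b c d e \<or> (v, u) \<in> double_broom_edges a b c d e"
      using that by (simp add: double_broom_def)
    then show ?thesis
      using arcs sym by blast
  qed
  then show ?thesis
    unfolding contains_subgraph_def using inj img by blast
qed

lemma out_degree_eq_degree_in: "out_degree (with_proj G) v = degree_in (\<lambda>x y. (x, y) \<in> parcs G) v"
proof -
  have "out_arcs (with_proj G) v = Pair v ` {w. (v, w) \<in> parcs G}"
    by (auto simp: out_arcs_def)
  then show ?thesis
    by (simp add: out_degree_def degree_in_def card_image inj_on_def)
qed

theorem theorem3:
  fixes k l c n :: nat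
    and G :: "'a pair_pre_digraph"
    and T :: "'b pair_pre_digraph"
  assumes "k \<ge> 1" and "l \<ge> 1" and "c \<ge> 1" and "n \<ge> 1"
    and "l \<ge> c"
    and "T \<in> tree_class k l c"
    and "pair_graph G"
    and "card (pverts G) = n"
    and "real (card {v \<in> pverts G. out_degree (with_proj G) v \<ge> k}) \<ge> real n / 2"
    and "even c \<or> int (l + c) \<ge> \<lfloor>real n / 2\<rfloor>"
  shows "contains_subgraph G T"
proof -
  let ?E = "\<lambda>x y. (x, y) \<in> parcs G"
  obtain a b d e where T: "b + d = l" "a + b + c + d + e = k"
      "digraph_iso (with_proj (double_broom a b c d e)) (with_proj T)"
    using assms(6) by (auto simp: tree_class_def)
  interpret G: pair_graph G
    by fact
  have sg: "simple_graph (pverts G) ?E"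
  proof
    show "\<not> (x, x) \<in> parcs G" for x
      using G.no_loops[of "(x, x)"] by auto
  qed (use G.pair_finite_verts G.graph_symmetric G.in_arcsD1 in blast)+
  have "real n \<le> real (2 * card (high (pverts G) ?E k))"
    using assms(9) by (simp add: out_degree_eq_degree_in high_def)
  then have "card (pverts G) \<le> 2 * card (high (pverts G) ?E k)"
    using assms(8) by linarith
  moreover have "pverts G \<noteq> {}"
    using assms(4,8) by auto
  moreover have "\<lfloor>real n / 2\<rfloor> = int (n div 2)"
    using floor_divide_of_nat_eq[of n 2] by simp
  then have "even c \<or> card (pverts G) div 2 \<le> l + c"
    using assms(8,10) by (metis of_nat_le_iff)
  moreover have "k = a + c + e + l"
    using T(1,2) by simp
  ultimately have "spaced_path (pverts G) ?E k a c e"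
    using spaced_path_exists[OF sg] assms(3,5) by blast
  then have "contains_subgraph G (double_broom a b c d e)"
    by (rule double_broom_if_spaced_path[OF sg]) (simp add: T(2))
  then show ?thesis
    by (rule contains_subgraph_iso[OF T(3)])
qed

end
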